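(* Let $n\ge2$ and $p\in[2,\infty)$. Suppose that $\lambda_1\equiv M$, where $M$ is a nonnegative constant, and that $\lambda_2$ is a nonnegative continuous function on $[0,1)$ such that $$\sup_{r\in[0,1)}\int_0^r\frac{\rho^{n-1}g_n(\rho,r)\lambda_2(\rho)}{(1-\rho^2)^n}\,d\rho<\frac1{np},\qquad\text{where } g_n(\rho,r)=\frac1n\int_\rho^r\frac{(1-s^2)^{n-2}}{s^{n-1}}\,ds.$$ If $f\in\mathbf{H}_{\lambda_1,\lambda_2}(\mathbb{B}^n)$ satisfies $$M_p(r,\nabla f)=O\left(\frac1{1-r}\right)\quad\text{as } r\to1^-,$$ then $$M_p(r,f)=O\left(\left(\log\frac1{1-r}\right)^{\frac12}\right)\quad\text{as } r\to1^-.$$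
   Context: $\mathbb{B}^n$ and $\mathbb{S}^{n-1}$ are the open unit ball and unit sphere of $\mathbb{R}^n$; $\sigma$ is the normalized surface measure on $\mathbb{S}^{n-1}$. For $f$ on $\mathbb{B}^n$ with values in some $\mathbb{R}^\nu$ and measurable, $M_p(r,f)=\left(\int_{\mathbb{S}^{n-1}}|f(r\zeta)|^p\,d\sigma(\zeta)\right)^{1/p}$. The Möbius invariant (hyperbolic) Laplacian is $$\Delta_hf(x)=(1-|x|^2)\left[(1-|x|^2)\Delta f(x)+2(n-2)\langle\nabla f(x),x\rangle\right],$$ with $\Delta$ the Euclidean Laplacian, and $|\nabla^hf(x)|^2=(1-|x|^2)^2|\nabla f(x)|^2$. $\mathbf{H}_{\lambda_1,\lambda_2}(\mathbb{B}^n)$ is the class of all $f\in C^2(\mathbb{B}^n)$, $f:\mathbb{B}^n\to\mathbb{R}$, satisfying $$0\le f(x)\Delta_hf(x)\le\lambda_1(|x|)|\nabla^hf(x)|^2+\lambda_2(|x|)|f(x)|^2,\quad x\in\mathbb{B}^n.$$ *)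

theory Defs
  imports "HOL-Analysis.Analysis" "HOL-Library.Landau_Symbols"
begin

text \<open>The ambient space \<open>\<real>\<^sup>n\<close> is \<open>real ^ 'n\<close>, with \<open>n = CARD('n)\<close>. Functions on the unit ball are
  total functions on this space; every notion below looks only at their values in the open ball.\<close>

definition partial_deriv :: "'n \<Rightarrow> (real ^ 'n \<Rightarrow> real) \<Rightarrow> real ^ 'n \<Rightarrow> real" where
  "partial_deriv i f x = frechet_derivative f (at x) (axis i 1)"

definition grad :: "(real ^ 'n \<Rightarrow> real) \<Rightarrow> real ^ 'n \<Rightarrow> real ^ 'n" where
  "grad f x = (\<chi> i. partial_deriv i f x)"

definition laplacian :: "(real ^ 'n \<Rightarrow> real) \<Rightarrow> real ^ 'n \<Rightarrow> real" where
  "laplacian f x = (\<Sum>i\<in>UNIV. partial_deriv i (partial_deriv i f) x)"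

text \<open>Meant for open \<open>S\<close>. Differentiability of \<open>f\<close> and of its first partial derivatives makes
  all the Frechet derivatives involved genuine, and differentiability implies continuity, so
  continuity has to be required only at second order.\<close>

definition C2_on :: "(real ^ 'n) set \<Rightarrow> (real ^ 'n \<Rightarrow> real) \<Rightarrow> bool" where
  "C2_on S f \<longleftrightarrow>
     f differentiable_on S \<and>
     (\<forall>i. partial_deriv i f differentiable_on S) \<and>
     (\<forall>i j. continuous_on S (partial_deriv i (partial_deriv j f)))"

definition hyp_laplacian :: "(real ^ 'n \<Rightarrow> real) \<Rightarrow> real ^ 'n \<Rightarrow> real" where
  "hyp_laplacian f x =
     (1 - (norm x)\<^sup>2) *
       ((1 - (norm x)\<^sup>2) * laplacian f x + 2 * (real CARD('n) - 2) * (grad f x \<bullet> x))"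

definition hyp_grad :: "(real ^ 'n \<Rightarrow> real) \<Rightarrow> real ^ 'n \<Rightarrow> real ^ 'n" where
  "hyp_grad f x = (1 - (norm x)\<^sup>2) *\<^sub>R grad f x"

definition H_class :: "(real \<Rightarrow> real) \<Rightarrow> (real \<Rightarrow> real) \<Rightarrow> (real ^ 'n \<Rightarrow> real) set" where
  "H_class l\<^sub>1 l\<^sub>2 =
     {f. C2_on (ball 0 1) f \<and>
         (\<forall>x\<in>ball 0 1.
            0 \<le> f x * hyp_laplacian f x \<and>
            f x * hyp_laplacian f x
              \<le> l\<^sub>1 (norm x) * (norm (hyp_grad f x))\<^sup>2 + l\<^sub>2 (norm x) * \<bar>f x\<bar>\<^sup>2)}"

text \<open>Normalized surface measure on the unit sphere, in its cone form: a Borel set \<open>A\<close> of the sphere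
  has the measure of the cone \<open>{t *\<^sub>R \<zeta> | t \<zeta>. 0 < t \<and> t < 1 \<and> \<zeta> \<in> A}\<close> divided by the volume
  of the unit ball. Here \<open>sgn x = x /\<^sub>R norm x\<close>. As a measure it lives on the Borel sets of
  the whole space and is concentrated on the sphere; the origin, where \<open>sgn\<close> vanishes, is a
  null set.\<close>

definition sphere_measure :: "(real ^ 'n) measure" where
  "sphere_measure = distr (uniform_measure lborel (ball 0 1)) borel sgn"

text \<open>The Bochner integral is \<open>0\<close> for non-integrable integrands, so this is the integral mean only
  where the integral is finite; that is the case for continuous \<open>f\<close> and \<open>0 \<le> r < 1\<close>.\<close>

definition integral_mean ::
  "real \<Rightarrow> real \<Rightarrow> (real ^ 'n \<Rightarrow> 'b::euclidean_space) \<Rightarrow> real" where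
  "integral_mean p r f =
     (LINT \<zeta>:sphere 0 1|sphere_measure. norm (f (r *\<^sub>R \<zeta>)) powr p) powr (1 / p)"

text \<open>For \<open>n \<ge> 2\<close> the integral diverges at \<open>\<rho> = 0\<close>, where Isabelle assigns it the value \<open>0\<close>. The
  Green function is only used inside an integral over \<open>\<rho>\<close>, where one point does not
  matter.\<close>

definition green :: "nat \<Rightarrow> real \<Rightarrow> real \<Rightarrow> real" where
  "green n \<rho> r = 1 / real n * integral {\<rho>..r} (\<lambda>s. (1 - s\<^sup>2) ^ (n - 2) / s ^ (n - 1))"

end

theory Submission
  imports Defs
begin

text \<open>Put \<open>u = (1 + f\<^sup>2)\<^bsup>p/2\<^esup>\<close>. It dominates \<open>|f|\<^sup>p\<close> and is \<open>C\<^sup>2\<close> for every \<open>p\<close>, including at the zeros of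
  \<open>f\<close>. The class condition gives \<open>\<Delta>\<^sub>h u \<ge> 0\<close> and
  \<open>\<Delta>\<^sub>h u \<le> p (p - 1 + M) (1 - |x|\<^sup>2)\<^sup>2 (1 + f\<^sup>2)\<^bsup>p/2-1\<^esup> |\<nabla>f|\<^sup>2 + p \<lambda>\<^sub>2 u\<close>, so the spherical mean
  \<open>m(r)\<close> of \<open>u\<close> increases with \<open>r\<close>. Green's formula expresses \<open>m(r)\<close> as the integral of
  \<open>\<Delta>\<^sub>h u\<close> against \<open>n \<rho>\<^bsup>n-1\<^esup> g\<^sub>n(\<rho>, r) (1 - \<rho>\<^sup>2)\<^bsup>-n\<^esup>\<close> plus bounded terms. The part with \<open>\<lambda>\<^sub>2\<close> is at
  most \<open>\<kappa> m(r)\<close> with \<open>\<kappa> < 1\<close> and is absorbed. In the gradient part, Young's inequality and the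
  growth of \<open>M\<^sub>p(r, \<nabla>f)\<close> give \<open>m(r)\<^bsup>1-2/p\<^esup>\<close> times \<open>(1 - \<rho>)\<^bsup>-2\<^esup>\<close>, the Green weight leaves
  \<open>(1 - \<rho>)\<^bsup>-1\<^esup>\<close>, and so \<open>m(r)\<^bsup>2/p\<^esup> = O(log (1/(1 - r)))\<close>.

  The differential equation for spherical means comes from rotation invariance of the sphere
  measure alone: differentiating along plane rotations replaces the divergence theorem.\<close>

section \<open>Orthogonal invariance of Lebesgue measure\<close>

lemma nn_integral_lborel_diff:
  fixes g :: "'a::euclidean_space \<Rightarrow> ennreal"
  assumes [measurable]: "g \<in> borel_measurable borel"
  shows "(\<integral>\<^sup>+x. g (a - x) \<partial>lborel) = (\<integral>\<^sup>+x. g x \<partial>lborel)"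
proof -
  have "lborel = distr lborel borel (\<lambda>x::'a. a - x)"
    using lborel_affine[of "-1" a] by (simp add: density_1)
  then have "(\<integral>\<^sup>+x. g x \<partial>lborel) = (\<integral>\<^sup>+x. g x \<partial>distr lborel borel (\<lambda>x. a - x))"
    by simp
  also have "\<dots> = (\<integral>\<^sup>+x. g (a - x) \<partial>lborel)"
    by (subst nn_integral_distr) auto
  finally show ?thesis ..
qed

lemma nn_integral_lborel_add:
  fixes g :: "'a::euclidean_space \<Rightarrow> ennreal"
  assumes [measurable]: "g \<in> borel_measurable borel"
  shows "(\<integral>\<^sup>+x. g (x + a) \<partial>lborel) = (\<integral>\<^sup>+x. g x \<partial>lborel)"
proof -
  have "(\<integral>\<^sup>+x. g x \<partial>lborel) = (\<integral>\<^sup>+x. g x \<partial>distr lborel borel ((+) a))"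
    by (simp add: lborel_distr_plus)
  also have "\<dots> = (\<integral>\<^sup>+x. g (x + a) \<partial>lborel)"
    by (subst nn_integral_distr) (auto simp: add.commute)
  finally show ?thesis ..
qed

text \<open>Uniqueness of translation-invariant measures: \<open>\<integral>\<integral> 1\<^sub>A(x) 1\<^sub>B(R y - x) dx dy\<close> is
  symmetric in \<open>A\<close> and \<open>B\<close>, and the unit ball fixes the constant.\<close>

lemma lborel_distr_orthogonal:
  fixes R :: "'a::euclidean_space \<Rightarrow> 'a"
  assumes R: "orthogonal_transformation R"
  shows "distr lborel borel R = lborel"
proof -
  have lin: "linear R" and nrm: "\<And>x. norm (R x) = norm x"
    using R by (auto simp: orthogonal_transformation)
  have [measurable]: "R \<in> borel_measurable borel"
    by (intro borel_measurable_continuous_onI linear_continuous_on)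
       (simp add: lin linear_conv_bounded_linear[symmetric])
  have surj: "\<exists>z. R z = x" for x
    using orthogonal_transformation_surj[OF R] by (metis surjD)
  \<comment> \<open>Surjectivity of \<open>R\<close> turns a translation performed after
    \<open>R\<close> into one performed before it, so the image measure inherits translation
    invariance.\<close>
  have shift: "(\<integral>\<^sup>+y. g (R y - x) \<partial>lborel) = (\<integral>\<^sup>+y. g (R y) \<partial>lborel)"
    if [measurable]: "g \<in> borel_measurable borel" for g :: "'a \<Rightarrow> ennreal" and x
  proof -
    obtain z where "R z = x" using surj by blast
    then have "(\<integral>\<^sup>+y. g (R y - x) \<partial>lborel) = (\<integral>\<^sup>+y. g (R (y + - z)) \<partial>lborel)"
      by (auto intro!: nn_integral_cong simp: linear_diff[OF lin])
    also have "\<dots> = (\<integral>\<^sup>+y. g (R y) \<partial>lborel)"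
      by (rule nn_integral_lborel_add) measurable
    finally show ?thesis .
  qed
  define I where "I A B = (\<integral>\<^sup>+y. (\<integral>\<^sup>+x. indicator A x * indicator B (R y - x) \<partial>lborel) \<partial>lborel)"
    for A B :: "'a set"
  have I1: "I A B = emeasure lborel A * emeasure (distr lborel borel R) B"
    if [measurable]: "A \<in> sets borel" "B \<in> sets borel" for A B :: "'a set"
  proof -
    have "I A B = (\<integral>\<^sup>+x. (\<integral>\<^sup>+y. indicator A x * indicator B (R y - x) \<partial>lborel) \<partial>lborel)"
      unfolding I_def by (rule lborel_pair.Fubini') measurable
    also have "\<dots> = (\<integral>\<^sup>+x. indicator A x * (\<integral>\<^sup>+y. indicator B (R y) \<partial>lborel) \<partial>lborel)"
    proof (rule nn_integral_cong)
      fix x :: 'a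
      have "(\<integral>\<^sup>+y. indicator A x * indicator B (R y - x) \<partial>lborel)
          = indicator A x * (\<integral>\<^sup>+y. indicator B (R y - x) \<partial>lborel)"
        by (rule nn_integral_cmult) measurable
      then show "(\<integral>\<^sup>+y. indicator A x * indicator B (R y - x) \<partial>lborel)
          = indicator A x * (\<integral>\<^sup>+y. indicator B (R y) \<partial>lborel)"
        using shift[of "indicator B" x] by simp
    qed
    also have "(\<integral>\<^sup>+y. indicator B (R y) \<partial>lborel) = emeasure (distr lborel borel R) B"
      using nn_integral_distr[of R lborel borel "indicator B"] by simp
    finally show ?thesis
      by (simp add: nn_integral_multc)
  qed
  \<comment> \<open>The substitution of \<open>R y - x\<close> for \<open>x\<close> exchanges the
    two indicators.\<close>
  have I2: "I A B = I B A"
    if [measurable]: "A \<in> sets borel" "B \<in> sets borel" for A B :: "'a set"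
    unfolding I_def
  proof (rule nn_integral_cong)
    fix y :: 'a
    show "(\<integral>\<^sup>+x. indicator A x * indicator B (R y - x) \<partial>lborel)
        = (\<integral>\<^sup>+x. indicator B x * indicator A (R y - x) \<partial>lborel)"
      using nn_integral_lborel_diff[of "\<lambda>x. indicator A x * indicator B (R y - x)" "R y"]
      by (simp add: mult.commute)
  qed
  show ?thesis
  proof (rule measure_eqI)
    fix A assume "A \<in> sets (distr lborel borel R)"
    then have A: "A \<in> sets borel" by simp
    \<comment> \<open>\<open>R\<close> maps the unit ball onto itself, so testing the symmetry
      against the ball forces the proportionality constant to be 1. The volume of the ball is
      positive and finite and can be cancelled.\<close>
    let ?B = "ball 0 1 :: 'a set"
    have "R -` ?B = ?B" using nrm by (auto simp: dist_norm)
    then have "emeasure (distr lborel borel R) ?B = emeasure lborel ?B"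
      by (subst emeasure_distr) auto
    with I1[OF A, of ?B] I1[of ?B A] I2[OF A, of ?B] A
    have "emeasure lborel ?B * emeasure lborel A
        = emeasure lborel ?B * emeasure (distr lborel borel R) A"
      by (simp add: mult.commute)
    moreover have "emeasure lborel ?B \<noteq> 0"
      using content_ball_pos[of 1 "0::'a"] by (auto simp: measure_def)
    moreover have "emeasure lborel ?B \<noteq> \<infinity>"
      using emeasure_lborel_ball_finite[of "0::'a" 1] by simp
    ultimately show "emeasure (distr lborel borel R) A = emeasure lborel A"
      by (simp add: ennreal_mult_cancel_left)
  qed simp
qed

section \<open>Integration over the sphere\<close>

text \<open>This is the set integral inside \<open>integral_mean\<close>. Its indicator allows
  integrands that are controlled on the sphere only.\<close>

definition sphere_integral :: "(real ^ 'n \<Rightarrow> real) \<Rightarrow> real" where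
  "sphere_integral w = (LINT \<zeta>:sphere 0 1|sphere_measure. w \<zeta>)"

section \<open>Total mass of the sphere measure and integrability of continuous functions\<close>

lemma sets_sphere_measure [measurable_cong, simp]: "sets sphere_measure = sets borel"
  by (simp add: sphere_measure_def)

lemma measurable_sgn_uniform_ball [measurable]:
  "sgn \<in> borel_measurable (uniform_measure lborel (ball (0 :: real ^ 'n) 1))"
  by (simp add: measurable_cong_sets[OF sets_uniform_measure refl])

lemma emeasure_lborel_unit_ball:
  "emeasure lborel (ball (0 :: 'a::euclidean_space) 1) \<noteq> 0"
  "emeasure lborel (ball (0 :: 'a::euclidean_space) 1) < \<infinity>"
  using content_ball_pos[of 1 "0::'a"] emeasure_lborel_ball_finite[of "0::'a" 1]
  by (auto simp: measure_def)

lemma finite_measure_sphere_measure: "finite_measure (sphere_measure :: (real ^ 'n) measure)"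
proof
  have "emeasure (sphere_measure :: (real ^ 'n) measure) (space sphere_measure)
      = emeasure (uniform_measure lborel (ball (0 :: real ^ 'n) 1)) UNIV"
    unfolding sphere_measure_def by (simp add: emeasure_distr)
  also have "\<dots> = 1"
    using emeasure_lborel_unit_ball[where ?'a = "real ^ 'n"]
    by (simp add: ennreal_divide_self)
  finally show "emeasure (sphere_measure :: (real ^ 'n) measure) (space sphere_measure) \<noteq> \<infinity>"
    by simp
qed

text \<open>\<open>sgn\<close> sends every point except the origin to the sphere, and the origin is
  a null set.\<close>

lemma emeasure_sphere: "emeasure sphere_measure (sphere (0 :: real ^ 'n) 1) = 1"
proof -
  let ?B = "ball (0 :: real ^ 'n) 1"
  have "emeasure sphere_measure (sphere (0 :: real ^ 'n) 1)
      = emeasure (uniform_measure lborel ?B) (sgn -` sphere 0 1)"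
    unfolding sphere_measure_def by (subst emeasure_distr) auto
  also have "sgn -` sphere 0 1 = - {0 :: real ^ 'n}"
    by (auto simp: norm_sgn)
  also have "emeasure (uniform_measure lborel ?B) (- {0}) = emeasure lborel (?B \<inter> - {0}) / emeasure lborel ?B"
    by (subst emeasure_uniform_measure) auto
  also have "?B \<inter> - {0} = ?B - {0}" by auto
  also have "emeasure lborel (?B - {0}) = emeasure lborel ?B"
    by (rule emeasure_Diff_null_set) (auto simp: null_sets_def)
  also have "emeasure lborel ?B / emeasure lborel ?B = 1"
    using emeasure_lborel_unit_ball[where ?'a = "real ^ 'n"] by (simp add: ennreal_divide_self)
  finally show ?thesis .
qed

lemma sphere_integral_const [simp]: "sphere_integral (\<lambda>_ :: real ^ 'n. c) = c"
  unfolding sphere_integral_def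
  by (subst set_integral_const) (auto simp: emeasure_sphere measure_def)

lemma set_integrable_sphere:
  fixes w :: "real ^ 'n \<Rightarrow> real"
  assumes w: "continuous_on (sphere 0 1) w"
  shows "set_integrable sphere_measure (sphere 0 1) w"
proof -
  obtain c where "\<forall>y\<in>w ` sphere 0 1. norm y \<le> c"
    using compact_imp_bounded[OF compact_continuous_image[OF w compact_sphere]]
    unfolding bounded_iff by blast
  have "\<bar>w x\<bar> \<le> \<bar>c\<bar>" if "norm x = 1" for x
  proof -
    have "w x \<in> w ` sphere 0 1" using that by (intro imageI) simp
    then have "norm (w x) \<le> c" using \<open>\<forall>y\<in>w ` sphere 0 1. norm y \<le> c\<close> by blast
    then show ?thesis by simp
  qed
  then have "AE x in sphere_measure. norm (indicator (sphere 0 1) x *\<^sub>R w x) \<le> \<bar>c\<bar>"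
    by (intro AE_I2) (auto simp: indicator_def)
  moreover have "(\<lambda>x. indicator (sphere 0 1) x *\<^sub>R w x) \<in> borel_measurable sphere_measure"
    unfolding measurable_cong_sets[OF sets_sphere_measure refl]
    by (rule borel_measurable_continuous_on_indicator[OF _ w]) simp
  ultimately show ?thesis
    unfolding set_integrable_def by (rule finite_measure.integrable_const_bound[OF finite_measure_sphere_measure])
qed

section \<open>Linearity and monotonicity of the sphere integral\<close>

context
  fixes v w :: "real ^ 'n \<Rightarrow> real"
  assumes v: "continuous_on (sphere 0 1) v" and w: "continuous_on (sphere 0 1) w"
begin

lemma sphere_integral_add:
  "sphere_integral (\<lambda>\<zeta>. v \<zeta> + w \<zeta>) = sphere_integral v + sphere_integral w"
  unfolding sphere_integral_def using v w
  by (intro set_integral_add set_integrable_sphere)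

lemma sphere_integral_diff:
  "sphere_integral (\<lambda>\<zeta>. v \<zeta> - w \<zeta>) = sphere_integral v - sphere_integral w"
  unfolding sphere_integral_def using v w
  by (intro set_integral_diff set_integrable_sphere)

lemma sphere_integral_mono:
  "(\<And>\<zeta>. norm \<zeta> = 1 \<Longrightarrow> v \<zeta> \<le> w \<zeta>) \<Longrightarrow> sphere_integral v \<le> sphere_integral w"
  unfolding sphere_integral_def using v w
  by (intro set_integral_mono set_integrable_sphere) auto

end

lemma sphere_integral_cmult: "sphere_integral (\<lambda>\<zeta>. c * w \<zeta>) = c * sphere_integral w"
  unfolding sphere_integral_def by simp

lemma sphere_integral_cong:
  "(\<And>\<zeta>. norm \<zeta> = 1 \<Longrightarrow> v \<zeta> = w \<zeta>) \<Longrightarrow> sphere_integral v = sphere_integral w"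
  unfolding sphere_integral_def by (intro set_lebesgue_integral_cong) auto

lemma sphere_integral_sum:
  fixes w :: "'b \<Rightarrow> real ^ 'n \<Rightarrow> real"
  assumes "finite I" "\<And>i. i \<in> I \<Longrightarrow> continuous_on (sphere 0 1) (w i)"
  shows "sphere_integral (\<lambda>\<zeta>. \<Sum>i\<in>I. w i \<zeta>) = (\<Sum>i\<in>I. sphere_integral (w i))"
  using assms
  by (induction I rule: finite_induct) (auto simp: sphere_integral_add continuous_on_sum)

lemma sphere_integral_abs_le:
  fixes w :: "real ^ 'n \<Rightarrow> real"
  assumes w: "continuous_on (sphere 0 1) w" and c: "\<And>\<zeta>. norm \<zeta> = 1 \<Longrightarrow> \<bar>w \<zeta>\<bar> \<le> c"
  shows "\<bar>sphere_integral w\<bar> \<le> c"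
proof -
  have "sphere_integral w \<le> sphere_integral (\<lambda>_ :: real ^ 'n. c)"
    using c w by (intro sphere_integral_mono) (auto simp: abs_le_iff)
  moreover have "sphere_integral (\<lambda>_ :: real ^ 'n. - c) \<le> sphere_integral w"
    using c w by (intro sphere_integral_mono) (auto simp: abs_le_iff minus_le_iff)
  ultimately show ?thesis by simp
qed

text \<open>A linear isometry commutes with \<open>sgn\<close>. Hence the invariance of the uniform
  distribution on the ball passes to its image under \<open>sgn\<close>.\<close>

lemma sphere_measure_distr_orthogonal:
  fixes R :: "real ^ 'n \<Rightarrow> real ^ 'n"
  assumes R: "orthogonal_transformation R"
  shows "distr sphere_measure borel R = sphere_measure"
proof -
  let ?U = "uniform_measure lborel (ball (0 :: real ^ 'n) 1)"
  have lin: "linear R" and nrm: "\<And>x. norm (R x) = norm x"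
    using R by (auto simp: orthogonal_transformation)
  have Rm [measurable]: "R \<in> borel_measurable borel"
    by (intro borel_measurable_continuous_onI linear_continuous_on)
       (simp add: lin linear_conv_bounded_linear[symmetric])
  have [measurable]: "R \<in> borel_measurable ?U"
    by (simp add: measurable_cong_sets[OF sets_uniform_measure refl])
  have U: "distr ?U borel R = ?U"
  proof (rule measure_eqI)
    fix A assume "A \<in> sets (distr ?U borel R)"
    then have A [measurable]: "A \<in> sets borel" by simp
    have RA [measurable]: "R -` A \<in> sets borel"
      using measurable_sets[OF Rm A] by simp
    have "emeasure (distr ?U borel R) A = emeasure ?U (R -` A)"
      by (subst emeasure_distr) auto
    also have "\<dots> = emeasure lborel (ball 0 1 \<inter> R -` A) / emeasure lborel (ball (0 :: real ^ 'n) 1)"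
      using RA by (subst emeasure_uniform_measure) auto
    also have "ball 0 1 \<inter> R -` A = R -` (ball 0 1 \<inter> A)"
      by (auto simp: nrm)
    also have "emeasure lborel (R -` (ball 0 1 \<inter> A)) = emeasure (distr lborel borel R) (ball 0 1 \<inter> A)"
      by (subst emeasure_distr) auto
    also have "\<dots> = emeasure lborel (ball 0 1 \<inter> A)"
      by (simp add: lborel_distr_orthogonal[OF R])
    finally show "emeasure (distr ?U borel R) A = emeasure ?U A"
      by (simp add: emeasure_uniform_measure)
  qed simp
  have "distr sphere_measure borel R = distr ?U borel (R \<circ> sgn)"
    unfolding sphere_measure_def by (rule distr_distr) auto
  also have "R \<circ> sgn = sgn \<circ> R"
    by (auto simp: fun_eq_iff sgn_div_norm linear_scale[OF lin] nrm)
  also have "distr ?U borel (sgn \<circ> R) = distr (distr ?U borel R) borel sgn"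
    by (rule distr_distr[symmetric]) auto
  finally show ?thesis by (simp add: U sphere_measure_def)
qed

lemma sphere_integral_orthogonal:
  fixes w :: "real ^ 'n \<Rightarrow> real" and R :: "real ^ 'n \<Rightarrow> real ^ 'n"
  assumes R: "orthogonal_transformation R" and w: "continuous_on (sphere 0 1) w"
  shows "sphere_integral (\<lambda>\<zeta>. w (R \<zeta>)) = sphere_integral w"
proof -
  let ?w = "\<lambda>\<zeta>. indicator (sphere 0 1) \<zeta> *\<^sub>R w \<zeta>"
  have lin: "linear R" and nrm: "\<And>x. norm (R x) = norm x"
    using R by (auto simp: orthogonal_transformation)
  have Rm: "R \<in> measurable sphere_measure borel"
    unfolding measurable_cong_sets[OF sets_sphere_measure refl]
    by (intro borel_measurable_continuous_onI linear_continuous_on)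
       (simp add: lin linear_conv_bounded_linear[symmetric])
  have "sphere_integral w = integral\<^sup>L (distr sphere_measure borel R) ?w"
    unfolding sphere_measure_distr_orthogonal[OF R] sphere_integral_def set_lebesgue_integral_def ..
  also have "\<dots> = (LINT \<zeta>|sphere_measure. ?w (R \<zeta>))"
    by (rule integral_distr[OF Rm borel_measurable_continuous_on_indicator[OF _ w]]) simp
  also have "\<dots> = sphere_integral (\<lambda>\<zeta>. w (R \<zeta>))"
    unfolding sphere_integral_def set_lebesgue_integral_def
    by (rule Bochner_Integration.integral_cong) (simp_all add: indicator_def nrm)
  finally show ?thesis by (rule sym)
qed

text \<open>Compactness of the sphere gives a neighbourhood of \<open>t\<close> on which
  \<open>G'\<close> varies by at most \<open>e\<close>, uniformly in \<zeta>. The mean value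
  inequality then bounds the first-order remainder uniformly, and the bound survives
  integration.\<close>

lemma has_real_derivative_sphere_integral:
  fixes G :: "real \<Rightarrow> real ^ 'n \<Rightarrow> real"
  assumes T: "open T" "is_interval T" "t \<in> T"
    and der: "\<And>t \<zeta>. t \<in> T \<Longrightarrow> norm \<zeta> = 1 \<Longrightarrow> ((\<lambda>t. G t \<zeta>) has_real_derivative G' t \<zeta>) (at t)"
    and G: "\<And>t. t \<in> T \<Longrightarrow> continuous_on (sphere 0 1) (G t)"
    and G': "continuous_on (T \<times> sphere 0 1) (\<lambda>(t, \<zeta>). G' t \<zeta>)"
  shows "((\<lambda>t. sphere_integral (G t)) has_real_derivative sphere_integral (G' t)) (at t)"
proof -
  have "continuous_on (sphere 0 1) (\<lambda>\<zeta>. case (t, \<zeta>) of (t, \<zeta>) \<Rightarrow> G' t \<zeta>)"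
    using T by (intro continuous_on_compose2[OF G']) (auto intro!: continuous_intros)
  then have G't: "continuous_on (sphere 0 1) (G' t)" by simp
  show ?thesis
    unfolding has_field_derivative_def has_derivative_at_alt
  proof (intro conjI allI impI)
    fix e :: real assume "e > 0"
    obtain X where X: "t \<in> X" "open X"
      and X': "\<forall>s\<in>X \<inter> T. \<forall>\<zeta>\<in>sphere 0 1. dist (case (s, \<zeta>) of (t, \<zeta>) \<Rightarrow> G' t \<zeta>) (case (t, \<zeta>) of (t, \<zeta>) \<Rightarrow> G' t \<zeta>) \<le> e"
      by (rule continuous_on_prod_compactE[OF G' compact_sphere T(3) \<open>e > 0\<close>])
    have Xe: "\<bar>G' s \<zeta> - G' t \<zeta>\<bar> \<le> e" if "s \<in> X \<inter> T" "norm \<zeta> = 1" for s \<zeta>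
      using X' that by (simp add: dist_real_def)
    have "open (X \<inter> T)" using X T by auto
    then obtain d where "d > 0" and d: "ball t d \<subseteq> X \<inter> T"
      using X T by (meson IntI openE)
    have "norm (sphere_integral (G y) - sphere_integral (G t) - sphere_integral (G' t) * (y - t))
        \<le> e * norm (y - t)" if y: "norm (y - t) < d" for y
    proof -
      have yT: "y \<in> T" using d y by (auto simp: subset_iff dist_norm norm_minus_commute)
      have "sphere_integral (G y) - sphere_integral (G t) - sphere_integral (G' t) * (y - t)
          = sphere_integral (\<lambda>\<zeta>. G y \<zeta> - G t \<zeta> - (y - t) * G' t \<zeta>)"
        using G[OF yT] G[OF T(3)] G't
        by (simp add: sphere_integral_diff sphere_integral_cmult continuous_intros)
      also have "norm \<dots> \<le> e * norm (y - t)"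
        unfolding real_norm_def
      proof (rule sphere_integral_abs_le)
        show "continuous_on (sphere 0 1) (\<lambda>\<zeta>. G y \<zeta> - G t \<zeta> - (y - t) * G' t \<zeta>)"
          using G[OF yT] G[OF T(3)] G't by (intro continuous_intros)
        fix \<zeta> :: "real ^ 'n" assume z: "norm \<zeta> = 1"
        \<comment> \<open>Subtracting the linear function \<open>s * G' t \<zeta>\<close> of
          \<open>s\<close> leaves a function whose derivative on the ball is at most
          \<open>e\<close>.\<close>
        have "norm ((G y \<zeta> - y * G' t \<zeta>) - (G t \<zeta> - t * G' t \<zeta>)) \<le> e * norm (y - t)"
        proof (rule field_differentiable_bound[where S = "ball t d" and f' = "\<lambda>s. G' s \<zeta> - G' t \<zeta>"])
          fix s assume s: "s \<in> ball t d"
          then have "s \<in> X \<inter> T" using d by auto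
          then show "norm (G' s \<zeta> - G' t \<zeta>) \<le> e" using Xe z by auto
          show "((\<lambda>s. G s \<zeta> - s * G' t \<zeta>) has_field_derivative G' s \<zeta> - G' t \<zeta>) (at s within ball t d)"
            using \<open>s \<in> X \<inter> T\<close> z
            by (auto intro!: derivative_eq_intros DERIV_subset[OF der])
        qed (use y \<open>d > 0\<close> in \<open>auto simp: dist_norm norm_minus_commute\<close>)
        then show "\<bar>G y \<zeta> - G t \<zeta> - (y - t) * G' t \<zeta>\<bar> \<le> e * \<bar>y - t\<bar>"
          by (simp add: algebra_simps)
      qed
      finally show ?thesis .
    qed
    then show "\<exists>d>0. \<forall>y. norm (y - t) < d \<longrightarrow>
        norm (sphere_integral (G y) - sphere_integral (G t) - sphere_integral (G' t) * (y - t))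
        \<le> e * norm (y - t)"
      using \<open>d > 0\<close> by blast
  qed (simp add: bounded_linear_mult_right)
qed

section \<open>Infinitesimal rotations\<close>

text \<open>For distinct \<open>i\<close> and \<open>j\<close>, the rotation by the angle
  \<open>t\<close> in their coordinate plane. Writing it as the identity plus a correction along two
  axes avoids case distinctions on coordinates and makes the derivative in \<open>t\<close>
  visible.\<close>

definition plane_rotation :: "'n \<Rightarrow> 'n \<Rightarrow> real \<Rightarrow> real ^ 'n \<Rightarrow> real ^ 'n" where
  "plane_rotation i j t x =
     x + ((cos t - 1) * x $ i - sin t * x $ j) *\<^sub>R axis i 1
       + ((cos t - 1) * x $ j + sin t * x $ i) *\<^sub>R axis j 1"

lemma orthogonal_transformation_plane_rotation:
  fixes i j :: "'n::finite"
  assumes "i \<noteq> j"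
  shows "orthogonal_transformation (plane_rotation i j t)"
  unfolding orthogonal_transformation
proof (intro conjI allI)
  show "linear (plane_rotation i j t)"
    by (rule linearI) (simp_all add: plane_rotation_def algebra_simps)
  fix x :: "real ^ 'n"
  let ?x = "x $ i" and ?y = "x $ j" and ?c = "cos t" and ?s = "sin t"
  have "axis i 1 \<bullet> (axis j 1 :: real ^ 'n) = 0" "axis j 1 \<bullet> (axis i 1 :: real ^ 'n) = 0"
    using assms by (auto simp: inner_axis_axis)
  then have "(norm (plane_rotation i j t x))\<^sup>2
      = (norm x)\<^sup>2 + 2 * ((?c - 1) * ?x - ?s * ?y) * ?x + 2 * ((?c - 1) * ?y + ?s * ?x) * ?y
        + ((?c - 1) * ?x - ?s * ?y)\<^sup>2 + ((?c - 1) * ?y + ?s * ?x)\<^sup>2"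
    unfolding plane_rotation_def power2_norm_eq_inner
    by (simp add: inner_add_left inner_add_right inner_axis inner_axis' inner_axis_axis
        power2_eq_square algebra_simps)
  also have "\<dots> = (norm x)\<^sup>2 + (?s\<^sup>2 + ?c\<^sup>2 - 1) * (?x\<^sup>2 + ?y\<^sup>2)"
    by algebra
  finally show "norm (plane_rotation i j t x) = norm x"
    by simp
qed

text \<open>The integral of \<open>w\<close> composed with a plane rotation does not depend on the
  angle. The integrand here is the derivative of that composition at angle 0, so its integral
  vanishes; this acts as integration by parts on the sphere.\<close>

lemma sphere_integral_rotation_generator:
  fixes w :: "real ^ 'n \<Rightarrow> real"
  assumes w: "\<And>\<zeta>. norm \<zeta> = 1 \<Longrightarrow> (w has_derivative (\<lambda>h. W \<zeta> \<bullet> h)) (at \<zeta>)"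
    and W: "continuous_on (sphere 0 1) W"
  shows "sphere_integral (\<lambda>\<zeta>. \<zeta> $ i * W \<zeta> $ j - \<zeta> $ j * W \<zeta> $ i) = 0"
proof (cases "i = j")
  case False
  let ?R = "plane_rotation i j"
  define D :: "real \<Rightarrow> real ^ 'n \<Rightarrow> real ^ 'n" where "D t \<zeta> = (- sin t * \<zeta> $ i - cos t * \<zeta> $ j) *\<^sub>R axis i 1
       + (- sin t * \<zeta> $ j + cos t * \<zeta> $ i) *\<^sub>R axis j 1" for t \<zeta>
  note R = orthogonal_transformation_plane_rotation[OF False]
  have nrm: "norm (?R t \<zeta>) = norm \<zeta>" for t \<zeta>
    using R by (simp add: orthogonal_transformation)
  have wc: "continuous_on (sphere 0 1) w"
    using w by (auto intro!: continuous_at_imp_continuous_on has_derivative_continuous)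
  have der: "((\<lambda>t. sphere_integral (\<lambda>\<zeta>. w (?R t \<zeta>))) has_real_derivative
      sphere_integral (\<lambda>\<zeta>. W (?R 0 \<zeta>) \<bullet> D 0 \<zeta>)) (at 0)"
  proof (rule has_real_derivative_sphere_integral[where T = UNIV])
    fix t :: real and \<zeta> :: "real ^ 'n" assume z: "norm \<zeta> = 1"
    have "((\<lambda>t. ?R t \<zeta>) has_derivative (\<lambda>s. s *\<^sub>R D t \<zeta>)) (at t)"
      unfolding plane_rotation_def D_def
      by (auto intro!: derivative_eq_intros simp: algebra_simps)
    from has_derivative_compose[OF this w[of "?R t \<zeta>"]]
    show "((\<lambda>t. w (?R t \<zeta>)) has_real_derivative W (?R t \<zeta>) \<bullet> D t \<zeta>) (at t)"
      unfolding has_field_derivative_def using z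
      by (auto simp: nrm mult.commute fun_eq_iff elim!: has_derivative_eq_rhs)
  next
    fix t :: real
    show "continuous_on (sphere 0 1) (\<lambda>\<zeta>. w (?R t \<zeta>))"
    proof (rule continuous_on_compose2[OF wc])
      show "continuous_on (sphere 0 1) (?R t)"
        unfolding plane_rotation_def[abs_def] by (intro continuous_intros)
    qed (auto simp: nrm)
  next
    have "continuous_on (UNIV \<times> sphere 0 1) (\<lambda>x. W (?R (fst x) (snd x)) \<bullet> D (fst x) (snd x))"
    proof (intro continuous_on_inner continuous_on_compose2[OF W])
      show "continuous_on (UNIV \<times> sphere 0 1) (\<lambda>x. ?R (fst x) (snd x))"
        unfolding plane_rotation_def by (intro continuous_intros)
      show "continuous_on (UNIV \<times> sphere 0 1) (\<lambda>x. D (fst x) (snd x))"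
        unfolding D_def by (intro continuous_intros)
    qed (auto simp: nrm)
    then show "continuous_on (UNIV \<times> sphere 0 1) (\<lambda>(t, \<zeta>). W (?R t \<zeta>) \<bullet> D t \<zeta>)"
      by (simp add: case_prod_unfold)
  qed auto
  have "(\<lambda>t. sphere_integral (\<lambda>\<zeta>. w (?R t \<zeta>))) = (\<lambda>t. sphere_integral w)"
    using sphere_integral_orthogonal[OF R wc] by auto
  with der have "sphere_integral (\<lambda>\<zeta>. W (?R 0 \<zeta>) \<bullet> D 0 \<zeta>) = 0"
    using DERIV_unique DERIV_const by metis
  moreover have "W (?R 0 \<zeta>) \<bullet> D 0 \<zeta> = \<zeta> $ i * W \<zeta> $ j - \<zeta> $ j * W \<zeta> $ i" for \<zeta>
    by (simp add: plane_rotation_def D_def inner_add_right inner_diff_right inner_axis)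
  ultimately show ?thesis by simp
qed simp

text \<open>The rotation identity for \<open>\<zeta> \<mapsto> \<zeta>\<^sub>i U\<^sub>j(r \<zeta>)\<close>, summed over all \<open>i\<close> and \<open>j\<close>.\<close>

lemma sphere_integral_divergence:
  fixes U :: "real ^ 'n \<Rightarrow> real ^ 'n" and V :: "real ^ 'n \<Rightarrow> real ^ 'n ^ 'n"
  assumes U: "\<And>x j. norm x = \<bar>r\<bar> \<Longrightarrow> ((\<lambda>x. U x $ j) has_derivative (\<lambda>h. V x $ j \<bullet> h)) (at x)"
    and V: "continuous_on (sphere 0 \<bar>r\<bar>) V"
  shows "r * sphere_integral (\<lambda>\<zeta>. (\<Sum>j\<in>UNIV. V (r *\<^sub>R \<zeta>) $ j $ j) - \<zeta> \<bullet> (V (r *\<^sub>R \<zeta>) *v \<zeta>))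
       = (real CARD('n) - 1) * sphere_integral (\<lambda>\<zeta>. \<zeta> \<bullet> U (r *\<^sub>R \<zeta>))"
proof -
  let ?S = "sphere (0 :: real ^ 'n) 1"
  \<comment> \<open>By the product rule this is the gradient of
    \<open>\<zeta> $ i * U (r *\<^sub>R \<zeta>) $ j\<close> in \<zeta>; the dilation contributes
    the factor \<open>r\<close>.\<close>
  define W where "W i j \<zeta> = U (r *\<^sub>R \<zeta>) $ j *\<^sub>R axis i 1 + (\<zeta> $ i * r) *\<^sub>R V (r *\<^sub>R \<zeta>) $ j"
    for i j :: 'n and \<zeta> :: "real ^ 'n"
  have Ud: "((\<lambda>\<zeta>. U (r *\<^sub>R \<zeta>) $ j) has_derivative (\<lambda>h. V (r *\<^sub>R \<zeta>) $ j \<bullet> (r *\<^sub>R h))) (at \<zeta>)"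
    if "norm \<zeta> = 1" for \<zeta> j
  proof -
    have "((\<lambda>\<zeta>. r *\<^sub>R \<zeta>) has_derivative (\<lambda>h. r *\<^sub>R h)) (at \<zeta>)"
      by (auto intro!: derivative_eq_intros)
    from has_derivative_compose[OF this U] that show ?thesis by simp
  qed
  have Uc: "continuous_on ?S (\<lambda>\<zeta>. U (r *\<^sub>R \<zeta>) $ j)" for j
    using Ud by (auto intro!: continuous_at_imp_continuous_on has_derivative_continuous)
  have Vc: "continuous_on ?S (\<lambda>\<zeta>. V (r *\<^sub>R \<zeta>))"
    by (rule continuous_on_compose2[OF V]) (auto intro!: continuous_intros)
  have Wc: "continuous_on ?S (W i j)" for i j
    unfolding W_def[abs_def] by (intro continuous_intros Uc Vc)
  have "sphere_integral (\<lambda>\<zeta>. \<zeta> $ i * W i j \<zeta> $ j - \<zeta> $ j * W i j \<zeta> $ i) = 0" for i j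
  proof (rule sphere_integral_rotation_generator[OF _ Wc])
    fix \<zeta> :: "real ^ 'n" assume z: "norm \<zeta> = 1"
    have "((\<lambda>\<zeta>. \<zeta> $ i) has_derivative (\<lambda>h. h $ i)) (at \<zeta>)"
      by (simp add: bounded_linear_imp_has_derivative bounded_linear_vec_nth)
    from has_derivative_mult[OF this Ud[OF z, of j]]
    show "((\<lambda>\<zeta>. \<zeta> $ i * U (r *\<^sub>R \<zeta>) $ j) has_derivative (\<lambda>h. W i j \<zeta> \<bullet> h)) (at \<zeta>)"
      by (rule has_derivative_eq_rhs)
         (auto simp: W_def inner_add_left inner_axis' algebra_simps fun_eq_iff)
  qed
  then have "0 = sphere_integral (\<lambda>\<zeta>. \<Sum>i\<in>UNIV. \<Sum>j\<in>UNIV. \<zeta> $ i * W i j \<zeta> $ j - \<zeta> $ j * W i j \<zeta> $ i)"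
    using Wc by (simp add: sphere_integral_sum continuous_intros)
  also have "\<dots> = sphere_integral (\<lambda>\<zeta>. r * ((\<Sum>j\<in>UNIV. V (r *\<^sub>R \<zeta>) $ j $ j) - \<zeta> \<bullet> (V (r *\<^sub>R \<zeta>) *v \<zeta>))
      - (real CARD('n) - 1) * (\<zeta> \<bullet> U (r *\<^sub>R \<zeta>)))"
  proof (rule sphere_integral_cong)
    fix \<zeta> :: "real ^ 'n" assume z: "norm \<zeta> = 1"
    let ?V = "V (r *\<^sub>R \<zeta>)" and ?U = "U (r *\<^sub>R \<zeta>)"
    have z2: "(\<Sum>i\<in>UNIV. \<zeta> $ i * \<zeta> $ i) = 1"
      using z by (simp add: norm_eq_1 inner_vec_def)
    have "(\<Sum>i\<in>UNIV. \<Sum>j\<in>UNIV. \<zeta> $ i * W i j \<zeta> $ j - \<zeta> $ j * W i j \<zeta> $ i)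
        = (\<Sum>i\<in>UNIV. \<Sum>j\<in>UNIV. (if j = i then \<zeta> $ i * ?U $ i else 0) + r * (\<zeta> $ i * \<zeta> $ i * ?V $ j $ j)
             - \<zeta> $ j * ?U $ j - r * (\<zeta> $ j * (?V $ j $ i * \<zeta> $ i)))"
      by (intro sum.cong refl) (auto simp: W_def axis_def algebra_simps)
    \<comment> \<open>The diagonal \<open>i = j\<close> gives one copy of the inner product of
      \<zeta> and \<open>?U\<close>, the subtracted term gives \<open>CARD('n)\<close> copies: this
      is the origin of the factor \<open>CARD('n) - 1\<close>.\<close>
    also have "\<dots> = (\<Sum>i\<in>UNIV. \<zeta> $ i * ?U $ i)
        + r * ((\<Sum>i\<in>UNIV. \<zeta> $ i * \<zeta> $ i) * (\<Sum>j\<in>UNIV. ?V $ j $ j))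
        - real CARD('n) * (\<Sum>i\<in>UNIV. \<zeta> $ i * ?U $ i)
        - r * (\<Sum>i\<in>UNIV. \<Sum>j\<in>UNIV. \<zeta> $ j * (?V $ j $ i * \<zeta> $ i))"
      by (simp add: sum.distrib sum_subtractf sum_product sum_distrib_left[symmetric] mult.assoc)
    also have "(\<Sum>i\<in>UNIV. \<Sum>j\<in>UNIV. \<zeta> $ j * (?V $ j $ i * \<zeta> $ i)) = \<zeta> \<bullet> (?V *v \<zeta>)"
      by (subst sum.swap) (simp add: inner_vec_def matrix_vector_mult_def sum_distrib_left)
    finally show "(\<Sum>i\<in>UNIV. \<Sum>j\<in>UNIV. \<zeta> $ i * W i j \<zeta> $ j - \<zeta> $ j * W i j \<zeta> $ i)
      = r * ((\<Sum>j\<in>UNIV. ?V $ j $ j) - \<zeta> \<bullet> (?V *v \<zeta>)) - (real CARD('n) - 1) * (\<zeta> \<bullet> ?U)"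
      by (simp add: z2 inner_vec_def algebra_simps)
  qed
  also have "\<dots> = r * sphere_integral (\<lambda>\<zeta>. (\<Sum>j\<in>UNIV. V (r *\<^sub>R \<zeta>) $ j $ j) - \<zeta> \<bullet> (V (r *\<^sub>R \<zeta>) *v \<zeta>))
       - (real CARD('n) - 1) * sphere_integral (\<lambda>\<zeta>. \<zeta> \<bullet> U (r *\<^sub>R \<zeta>))"
  proof -
    have 1: "continuous_on ?S (\<lambda>\<zeta>. \<zeta> \<bullet> U (r *\<^sub>R \<zeta>))"
      unfolding inner_vec_def by (simp, intro continuous_intros Uc)
    have 2: "continuous_on ?S (\<lambda>\<zeta>. (\<Sum>j\<in>UNIV. V (r *\<^sub>R \<zeta>) $ j $ j) - \<zeta> \<bullet> (V (r *\<^sub>R \<zeta>) *v \<zeta>))"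
      unfolding inner_vec_def matrix_vector_mult_def
      by (simp, intro continuous_intros Vc)
    show ?thesis
      by (subst sphere_integral_diff)
         (use 1 2 in \<open>auto simp: sphere_integral_cmult intro!: continuous_on_mult continuous_on_const\<close>)
  qed
  finally show ?thesis by simp
qed

section \<open>Spherical means of the hyperbolic Laplacian\<close>

text \<open>Gradient \<open>U\<close> and Hessian \<open>V\<close> are explicit data, row
  \<open>j\<close> of \<open>V\<close> being the gradient of component \<open>j\<close> of
  \<open>U\<close>. In this way compositions with scalar functions can be handled by formulas
  instead of \<open>frechet_derivative\<close>.\<close>

locale C2_ball =
  fixes u :: "real ^ 'n \<Rightarrow> real" and U :: "real ^ 'n \<Rightarrow> real ^ 'n" and V :: "real ^ 'n \<Rightarrow> real ^ 'n ^ 'n"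
  assumes u: "\<And>x. norm x < 1 \<Longrightarrow> (u has_derivative (\<lambda>h. U x \<bullet> h)) (at x)"
    and U: "\<And>x j. norm x < 1 \<Longrightarrow> ((\<lambda>x. U x $ j) has_derivative (\<lambda>h. V x $ j \<bullet> h)) (at x)"
    and V: "continuous_on (ball 0 1) V"
begin

text \<open>As the trace of the Hessian, this is the Euclidean Laplacian of \<open>u\<close>;
  \<open>lap\<close> below is then the invariant one.\<close>

definition tr :: "real ^ 'n \<Rightarrow> real" where
  "tr x = (\<Sum>j\<in>UNIV. V x $ j $ j)"

definition lap :: "real ^ 'n \<Rightarrow> real" where
  "lap x = (1 - (norm x)\<^sup>2) * ((1 - (norm x)\<^sup>2) * tr x + 2 * (real CARD('n) - 2) * (U x \<bullet> x))"

definition mean :: "real \<Rightarrow> real" where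
  "mean r = sphere_integral (\<lambda>\<zeta>. u (r *\<^sub>R \<zeta>))"

text \<open>\<open>DERIV_mean\<close> and \<open>DERIV_mean'\<close> identify \<open>mean'\<close>
  and \<open>mean''\<close> as the first two derivatives of \<open>mean\<close>.\<close>

definition mean' :: "real \<Rightarrow> real" where
  "mean' r = sphere_integral (\<lambda>\<zeta>. \<zeta> \<bullet> U (r *\<^sub>R \<zeta>))"

definition mean'' :: "real \<Rightarrow> real" where
  "mean'' r = sphere_integral (\<lambda>\<zeta>. \<zeta> \<bullet> (V (r *\<^sub>R \<zeta>) *v \<zeta>))"

lemma continuous_on_u: "continuous_on (ball 0 1) u"
  using u by (auto intro!: continuous_at_imp_continuous_on has_derivative_continuous)

lemma continuous_on_U: "continuous_on (ball 0 1) U"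
proof -
  have "continuous_on (ball 0 1) (\<lambda>x. \<chi> j. U x $ j)"
    using U by (intro continuous_on_vec_lambda)
      (auto intro!: continuous_at_imp_continuous_on has_derivative_continuous)
  then show ?thesis by simp
qed

lemma continuous_on_tr: "continuous_on (ball 0 1) tr"
  unfolding tr_def[abs_def] by (intro continuous_intros V)

lemma continuous_on_lap: "continuous_on (ball 0 1) lap"
  unfolding lap_def[abs_def] by (intro continuous_intros continuous_on_tr continuous_on_U)

section \<open>Radial derivatives of spherical means\<close>

lemma continuous_on_dilation:
  assumes "continuous_on (ball 0 1) (F :: real ^ 'n \<Rightarrow> 'b::topological_space)" "\<bar>r\<bar> < 1"
  shows "continuous_on (sphere 0 1) (\<lambda>\<zeta>. F (r *\<^sub>R \<zeta>))"
  by (rule continuous_on_compose2[OF assms(1)]) (use assms(2) in \<open>auto intro!: continuous_intros\<close>)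

lemma continuous_on_dilation_pair:
  assumes "continuous_on (ball 0 1) (F :: real ^ 'n \<Rightarrow> 'b::topological_space)"
  shows "continuous_on ({-1<..<1} \<times> sphere 0 1) (\<lambda>x. F (fst x *\<^sub>R snd x))"
  by (rule continuous_on_compose2[OF assms(1)]) (auto intro!: continuous_intros)

lemma dilation_has_derivative:
  "((\<lambda>t. t *\<^sub>R \<zeta>) has_derivative (\<lambda>s. s *\<^sub>R \<zeta>)) (at (t :: real))"
  by (auto intro!: derivative_eq_intros)

text \<open>The radius runs through a symmetric interval, so the derivative at 0 is two-sided; the
  monotonicity argument for \<open>flux\<close> starts there.\<close>

lemma DERIV_mean:
  assumes r: "\<bar>r\<bar> < 1"
  shows "(mean has_real_derivative mean' r) (at r)"
  unfolding mean_def[abs_def] mean'_def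
proof (rule has_real_derivative_sphere_integral[where T = "{-1<..<1}"])
  fix t :: real and \<zeta> :: "real ^ 'n"
  assume *: "t \<in> {-1<..<1}" "norm \<zeta> = 1"
  then have "norm (t *\<^sub>R \<zeta>) < 1" by auto
  from has_derivative_compose[OF dilation_has_derivative u[OF this]]
  show "((\<lambda>t. u (t *\<^sub>R \<zeta>)) has_real_derivative \<zeta> \<bullet> U (t *\<^sub>R \<zeta>)) (at t)"
    unfolding has_field_derivative_def
    by (auto simp: inner_commute mult.commute fun_eq_iff elim!: has_derivative_eq_rhs)
next
  show "continuous_on ({- 1<..<1} \<times> sphere 0 1) (\<lambda>(t, \<zeta>). \<zeta> \<bullet> U (t *\<^sub>R \<zeta>))"
    using continuous_on_dilation_pair[OF continuous_on_U]
    by (auto simp: case_prod_unfold intro!: continuous_intros)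
qed (use r continuous_on_dilation[OF continuous_on_u] in \<open>auto simp: is_interval_oo\<close>)

lemma DERIV_mean':
  assumes r: "\<bar>r\<bar> < 1"
  shows "(mean' has_real_derivative mean'' r) (at r)"
  unfolding mean'_def[abs_def] mean''_def
proof (rule has_real_derivative_sphere_integral[where T = "{-1<..<1}"])
  fix t :: real and \<zeta> :: "real ^ 'n"
  assume *: "t \<in> {-1<..<1}" "norm \<zeta> = 1"
  then have t: "norm (t *\<^sub>R \<zeta>) < 1" by auto
  have "((\<lambda>t. \<Sum>j\<in>UNIV. \<zeta> $ j * U (t *\<^sub>R \<zeta>) $ j) has_derivative
      (\<lambda>s. \<Sum>j\<in>UNIV. \<zeta> $ j * (V (t *\<^sub>R \<zeta>) $ j \<bullet> (s *\<^sub>R \<zeta>)))) (at t)"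
    by (intro has_derivative_sum has_derivative_mult_right
        has_derivative_compose[OF dilation_has_derivative U[OF t]])
  then show "((\<lambda>t. \<zeta> \<bullet> U (t *\<^sub>R \<zeta>)) has_real_derivative \<zeta> \<bullet> (V (t *\<^sub>R \<zeta>) *v \<zeta>)) (at t)"
    unfolding has_field_derivative_def inner_vec_def matrix_vector_mult_def
    by (auto simp: sum_distrib_left mult_ac fun_eq_iff elim!: has_derivative_eq_rhs)
next
  have "continuous_on ({- 1<..<1} \<times> sphere 0 1) (\<lambda>x. snd x \<bullet> (V (fst x *\<^sub>R snd x) *v snd x))"
    unfolding inner_vec_def matrix_vector_mult_def
    using continuous_on_dilation_pair[OF V]
    by (auto intro!: continuous_intros)
  then show "continuous_on ({- 1<..<1} \<times> sphere 0 1) (\<lambda>(t, \<zeta>). \<zeta> \<bullet> (V (t *\<^sub>R \<zeta>) *v \<zeta>))"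
    by (simp add: case_prod_unfold)
next
  fix t assume "t \<in> {-1<..<1::real}"
  then show "continuous_on (sphere 0 1) (\<lambda>\<zeta>. \<zeta> \<bullet> U (t *\<^sub>R \<zeta>))"
    using continuous_on_dilation[OF continuous_on_U, of t] by (auto intro!: continuous_intros)
qed (use r in \<open>auto simp: is_interval_oo\<close>)

text \<open>This is Darboux's equation, obtained from the divergence identity for the gradient field
  \<open>U\<close>. The factor \<open>r\<close> replaces a division, so the equation also covers the
  origin.\<close>

lemma spherical_mean_laplacian:
  assumes r: "\<bar>r\<bar> < 1"
  shows "r * sphere_integral (\<lambda>\<zeta>. tr (r *\<^sub>R \<zeta>)) = r * mean'' r + (real CARD('n) - 1) * mean' r"
proof -
  have *: "sphere_integral (\<lambda>\<zeta>. tr (r *\<^sub>R \<zeta>) - \<zeta> \<bullet> (V (r *\<^sub>R \<zeta>) *v \<zeta>))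
      = sphere_integral (\<lambda>\<zeta>. tr (r *\<^sub>R \<zeta>)) - mean'' r"
    unfolding mean''_def
  proof (rule sphere_integral_diff)
    show "continuous_on (sphere 0 1) (\<lambda>\<zeta>. tr (r *\<^sub>R \<zeta>))"
      by (rule continuous_on_dilation[OF continuous_on_tr r])
    show "continuous_on (sphere 0 1) (\<lambda>\<zeta>. \<zeta> \<bullet> (V (r *\<^sub>R \<zeta>) *v \<zeta>))"
      unfolding inner_vec_def matrix_vector_mult_def
      using continuous_on_dilation[OF V r] by (auto intro!: continuous_intros)
  qed
  have "r * sphere_integral (\<lambda>\<zeta>. tr (r *\<^sub>R \<zeta>) - \<zeta> \<bullet> (V (r *\<^sub>R \<zeta>) *v \<zeta>))
      = (real CARD('n) - 1) * mean' r"
    unfolding mean'_def tr_def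
    by (rule sphere_integral_divergence) (use r in \<open>auto intro!: U continuous_on_subset[OF V]\<close>)
  then show ?thesis unfolding * by (simp add: algebra_simps)
qed

lemma sphere_integral_lap:
  assumes r: "\<bar>r\<bar> < 1"
  shows "sphere_integral (\<lambda>\<zeta>. lap (r *\<^sub>R \<zeta>))
    = (1 - r\<^sup>2) * ((1 - r\<^sup>2) * sphere_integral (\<lambda>\<zeta>. tr (r *\<^sub>R \<zeta>)) + 2 * (real CARD('n) - 2) * (r * mean' r))"
proof -
  have "sphere_integral (\<lambda>\<zeta>. lap (r *\<^sub>R \<zeta>)) = sphere_integral (\<lambda>\<zeta>. ((1 - r\<^sup>2)\<^sup>2) * tr (r *\<^sub>R \<zeta>)
      + ((1 - r\<^sup>2) * 2 * (real CARD('n) - 2) * r) * (\<zeta> \<bullet> U (r *\<^sub>R \<zeta>)))"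
    by (rule sphere_integral_cong)
       (auto simp: lap_def power2_eq_square inner_commute algebra_simps)
  also have "\<dots> = ((1 - r\<^sup>2)\<^sup>2) * sphere_integral (\<lambda>\<zeta>. tr (r *\<^sub>R \<zeta>))
      + ((1 - r\<^sup>2) * 2 * (real CARD('n) - 2) * r) * mean' r"
    unfolding mean'_def sphere_integral_cmult[symmetric]
    by (rule sphere_integral_add; intro continuous_intros continuous_on_dilation[OF continuous_on_tr r]
        continuous_on_dilation[OF continuous_on_U r])
  finally show ?thesis by (simp add: power2_eq_square algebra_simps)
qed

text \<open>On radial functions the invariant Laplacian has the divergence form (1 - r^2)^n /
  r^(n-1) d/dr (r^(n-1) (1 - r^2)^(2-n) d/dr). The flux is the quantity under the outer
  derivative.\<close>

definition flux :: "real \<Rightarrow> real" where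
  "flux r = r ^ (CARD('n) - 1) * mean' r / (1 - r\<^sup>2) ^ (CARD('n) - 2)"

lemma DERIV_flux:
  assumes n: "CARD('n) \<ge> 2" and r: "\<bar>r\<bar> < 1"
  shows "(flux has_real_derivative
    r ^ (CARD('n) - 1) / (1 - r\<^sup>2) ^ CARD('n) * sphere_integral (\<lambda>\<zeta>. lap (r *\<^sub>R \<zeta>))) (at r)"
proof -
  define k where "k = CARD('n) - 2"
  have k: "CARD('n) - 1 = Suc k" "CARD('n) - 2 = k" "CARD('n) = Suc (Suc k)"
    using n by (auto simp: k_def)
  define q where "q = 1 - r\<^sup>2"
  have q: "q > 0" using r by (simp add: q_def abs_square_less_1)
  define T where "T = sphere_integral (\<lambda>\<zeta>. tr (r *\<^sub>R \<zeta>))"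
  have T: "r * T = r * mean'' r + (real k + 1) * mean' r"
    using spherical_mean_laplacian[OF r] by (simp add: T_def k algebra_simps)
  \<comment> \<open>In dimension 2 we have \<open>k = 0\<close>, the exponent \<open>k - 1\<close>
    is truncated to 0, and the factor \<open>real k\<close> saves the identity.\<close>
  have dq: "real k * q ^ (k - 1) * q = real k * q ^ k"
    by (cases k) auto
  have 1: "((\<lambda>r. r ^ Suc k) has_real_derivative (real k + 1) * r ^ k) (at r)"
    using DERIV_pow[of "Suc k" r UNIV] by (simp add: add.commute)
  have 2: "((\<lambda>r. (1 - r\<^sup>2) ^ k) has_real_derivative real k * q ^ (k - 1) * (- 2 * r)) (at r)"
    unfolding q_def by (auto intro!: derivative_eq_intros)
  have "(flux has_real_derivative
      (((real k + 1) * r ^ k * mean' r + mean'' r * r ^ Suc k) * (1 - r\<^sup>2) ^ k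
        - (r ^ Suc k * mean' r) * (real k * q ^ (k - 1) * (- 2 * r)))
      / ((1 - r\<^sup>2) ^ k * (1 - r\<^sup>2) ^ k)) (at r)"
    unfolding flux_def[abs_def] k(1,2)
    by (rule DERIV_divide[OF DERIV_mult[OF 1 DERIV_mean'[OF r]] 2]) (use q in \<open>simp add: q_def\<close>)
  also have "(1 - r\<^sup>2) ^ k = q ^ k"
    by (simp add: q_def)
  also have "(real k + 1) * r ^ k * mean' r + mean'' r * r ^ Suc k = r ^ k * (r * T)"
    unfolding T by (simp add: algebra_simps)
  \<comment> \<open>The fraction is expanded by \<open>q\<close> so that \<open>dq\<close> can
    remove the exponent \<open>k - 1\<close>.\<close>
  also have "(r ^ k * (r * T) * q ^ k
        - (r ^ Suc k * mean' r) * (real k * q ^ (k - 1) * (- 2 * r))) / (q ^ k * q ^ k)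
      = (r ^ k * (r * T) * q ^ k * q
        + 2 * r * (r ^ Suc k * mean' r) * (real k * q ^ (k - 1) * q)) / (q ^ k * q ^ k * q)"
    using q by (simp add: field_simps)
  also have "\<dots> = r ^ Suc k / q ^ Suc (Suc k) * (q * (q * T + 2 * real k * (r * mean' r)))"
    unfolding dq using q by (simp add: field_simps)
  also have "q * (q * T + 2 * real k * (r * mean' r)) = sphere_integral (\<lambda>\<zeta>. lap (r *\<^sub>R \<zeta>))"
    using sphere_integral_lap[OF r] by (simp add: T_def q_def k)
  finally show ?thesis by (simp add: q_def k)
qed

end

section \<open>The Green function and Green's formula\<close>

context
  fixes n :: nat and r :: real
  assumes n: "n \<ge> 1" and r: "r < 1"
begin

lemma continuous_on_green_kernel:
  "0 < a \<Longrightarrow> continuous_on {a..r} (\<lambda>s. (1 - s\<^sup>2) ^ (n - 2) / s ^ (n - 1))"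
  by (intro continuous_intros) auto

lemma green_nonneg:
  assumes \<rho>: "0 < \<rho>"
  shows "0 \<le> green n \<rho> r"
  unfolding green_def using n \<rho> r
  by (intro mult_nonneg_nonneg Henstock_Kurzweil_Integration.integral_nonneg
      integrable_continuous_real continuous_on_green_kernel divide_nonneg_pos zero_le_power)
     (auto simp: power_le_one abs_square_le_1)

text \<open>The kernel decreases in \<open>s\<close>, so its value at \<rho> times the length of the
  interval bounds the integral. The factor \<open>1 - \<rho>\<close> gained here later weakens a
  singularity of order 2 at the boundary to one of order 1.\<close>

lemma green_le:
  assumes \<rho>: "0 < \<rho>" "\<rho> \<le> r"
  shows "real n * green n \<rho> r \<le> (1 - \<rho>\<^sup>2) ^ (n - 2) / \<rho> ^ (n - 1) * (1 - \<rho>)"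
proof -
  let ?c = "(1 - \<rho>\<^sup>2) ^ (n - 2) / \<rho> ^ (n - 1)"
  have "real n * green n \<rho> r = integral {\<rho>..r} (\<lambda>s. (1 - s\<^sup>2) ^ (n - 2) / s ^ (n - 1))"
    using n by (simp add: green_def)
  also have "\<dots> \<le> integral {\<rho>..r} (\<lambda>_. ?c)"
  proof (rule integral_le)
    show "(\<lambda>s. (1 - s\<^sup>2) ^ (n - 2) / s ^ (n - 1)) integrable_on {\<rho>..r}"
      using \<rho> by (intro integrable_continuous_real continuous_on_green_kernel)
    fix s assume s: "s \<in> {\<rho>..r}"
    then have "\<rho>\<^sup>2 \<le> s\<^sup>2" "s\<^sup>2 \<le> 1" "\<rho> ^ (n - 1) \<le> s ^ (n - 1)"
      using \<rho> r by (auto intro: power_mono power_le_one)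
    moreover have nn: "0 \<le> (1 - \<rho>\<^sup>2) ^ (n - 2)"
      using \<rho> r by (intro zero_le_power) (simp add: abs_square_le_1)
    ultimately show "(1 - s\<^sup>2) ^ (n - 2) / s ^ (n - 1) \<le> ?c"
      using \<rho> s by (intro frac_le[OF nn] power_mono) auto
  qed (rule integrable_const_ivl)
  also have "\<dots> = ?c * (r - \<rho>)" using \<rho> by simp
  also have "\<dots> \<le> ?c * (1 - \<rho>)"
    using \<rho> r by (intro mult_left_mono divide_nonneg_pos zero_le_power) (auto simp: abs_square_le_1)
  finally show ?thesis .
qed

lemma DERIV_green:
  assumes a: "0 < a" and \<rho>: "\<rho> \<in> {a..r}"
  shows "((\<lambda>\<rho>. real n * green n \<rho> r) has_real_derivative - ((1 - \<rho>\<^sup>2) ^ (n - 2) / \<rho> ^ (n - 1)))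
    (at \<rho> within {a..r})"
proof -
  have "(\<lambda>\<rho>. real n * green n \<rho> r) = (\<lambda>\<rho>. integral {\<rho>..r} (\<lambda>s. (1 - s\<^sup>2) ^ (n - 2) / s ^ (n - 1)))"
    using n by (simp add: green_def fun_eq_iff)
  then show ?thesis
    using integral_has_real_derivative'[OF continuous_on_green_kernel[OF a] \<rho>] by simp
qed

lemma continuous_on_green: "continuous_on {0<..r} (\<lambda>\<rho>. green n \<rho> r)"
  unfolding continuous_on_eq_continuous_within
proof
  fix \<rho> assume \<rho>: "\<rho> \<in> {0<..r}"
  \<comment> \<open>Continuity at \<rho> is local, so it may be read off on an interval that starts
    at \<open>\<rho>/2\<close>, away from the singularity.\<close>
  then have "continuous (at \<rho> within {\<rho>/2..r}) (\<lambda>\<rho>. real n * green n \<rho> r)"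
    by (intro DERIV_continuous[OF DERIV_green]) auto
  also have "at \<rho> within {\<rho>/2..r} = at \<rho> within {0<..r}"
    by (rule at_within_nhd[where S = "{\<rho>/2<..}"]) (use \<rho> in auto)
  finally have "continuous (at \<rho> within {0<..r}) (\<lambda>\<rho>. real n * green n \<rho> r)" .
  from continuous_mult[OF continuous_const this]
  have "continuous (at \<rho> within {0<..r}) (\<lambda>\<rho>. 1 / real n * (real n * green n \<rho> r))" .
  also have "(\<lambda>\<rho>. 1 / real n * (real n * green n \<rho> r)) = (\<lambda>\<rho>. green n \<rho> r)"
    using n by (simp add: fun_eq_iff)
  finally show "continuous (at \<rho> within {0<..r}) (\<lambda>\<rho>. green n \<rho> r)" .
qed

text \<open>The power of \<rho> cancels the singularity of the Green function at 0, so the weight is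
  bounded. Without integrability, \<open>integral\<close> would return the default value 0 and could
  not be compared with integrals over subintervals.\<close>

lemma green_weight_integrable:
  assumes l: "continuous_on {0..r} l"
  shows "(\<lambda>\<rho>. \<rho> ^ (n - 1) * green n \<rho> r * l \<rho> / (1 - \<rho>\<^sup>2) ^ n) integrable_on {0..r}"
proof -
  let ?w = "\<lambda>\<rho>. \<rho> ^ (n - 1) * green n \<rho> r * l \<rho> / (1 - \<rho>\<^sup>2) ^ n"
  have q: "0 < 1 - \<rho>\<^sup>2" if "\<rho> \<in> {0..r}" for \<rho>
    using that r by (simp add: abs_square_less_1)
  then have qn: "(1 - \<rho>\<^sup>2) ^ n \<noteq> 0" if "\<rho> \<in> {0..r}" for \<rho>
    using that by (metis less_irrefl power_not_zero)
  have "continuous_on {0..r} (\<lambda>\<rho>. l \<rho> / (1 - \<rho>\<^sup>2) ^ n)"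
    using qn by (intro continuous_intros l) blast
  from compact_imp_bounded[OF compact_continuous_image[OF this compact_Icc]]
  obtain C where "\<forall>y\<in>(\<lambda>\<rho>. l \<rho> / (1 - \<rho>\<^sup>2) ^ n) ` {0..r}. norm y \<le> C"
    unfolding bounded_iff by blast
  then have C: "\<bar>l \<rho> / (1 - \<rho>\<^sup>2) ^ n\<bar> \<le> C" if "\<rho> \<in> {0..r}" for \<rho>
    using that unfolding real_norm_def by blast
  \<comment> \<open>Continuity may fail at 0, where \<open>green\<close> can take a default value;
    this point is removed first and restored as a negligible set.\<close>
  have "?w integrable_on {0<..r}"
  proof (rule measurable_bounded_by_integrable_imp_integrable_real)
    show "?w \<in> borel_measurable (lebesgue_on {0<..r})"
    proof (rule continuous_imp_measurable_on_sets_lebesgue)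
      show "continuous_on {0<..r} ?w"
        using qn by (intro continuous_intros continuous_on_green continuous_on_subset[OF l] ballI qn) auto
    qed simp
    show "(\<lambda>_. C) integrable_on {0<..r}"
      by (rule integrable_spike_set[OF integrable_const_ivl[of C 0 r]])
         (auto intro: negligible_subset[of "{0}"])
    fix \<rho> assume \<rho>: "\<rho> \<in> {0<..r}"
    have "real n * green n \<rho> r * \<rho> ^ (n - 1) \<le> (1 - \<rho>\<^sup>2) ^ (n - 2) * (1 - \<rho>)"
      using green_le[of \<rho>] \<rho> by (simp add: field_simps)
    also have "\<dots> \<le> 1"
      using \<rho> r by (intro mult_le_one power_le_one) (auto simp: abs_square_le_1)
    finally have "real n * (green n \<rho> r * \<rho> ^ (n - 1)) \<le> 1"
      by (simp add: mult.assoc)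
    moreover have g0: "0 \<le> green n \<rho> r * \<rho> ^ (n - 1)"
      using \<rho> green_nonneg[of \<rho>] by simp
    moreover have "1 * (green n \<rho> r * \<rho> ^ (n - 1)) \<le> real n * (green n \<rho> r * \<rho> ^ (n - 1))"
      using n by (intro mult_right_mono g0) auto
    ultimately have "\<bar>green n \<rho> r * \<rho> ^ (n - 1)\<bar> \<le> 1" by linarith
    then have "\<bar>green n \<rho> r * \<rho> ^ (n - 1)\<bar> * \<bar>l \<rho> / (1 - \<rho>\<^sup>2) ^ n\<bar> \<le> 1 * C"
      using C[of \<rho>] \<rho> by (intro mult_mono) auto
    then show "\<bar>?w \<rho>\<bar> \<le> C"
      by (simp add: abs_mult mult_ac)
  qed simp
  then show ?thesis
    by (rule integrable_spike_set) (auto intro: negligible_subset[of "{0}"])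
qed

end

section \<open>Means of functions with nonnegative invariant Laplacian\<close>

context C2_ball
begin

context
  assumes n: "CARD('n) \<ge> 2" and lap_nonneg: "\<And>x. norm x < 1 \<Longrightarrow> 0 \<le> lap x"
begin

text \<open>The flux vanishes at 0, since its power of \<open>r\<close> has a positive exponent, and
  by \<open>DERIV_flux\<close> it is nondecreasing.\<close>

lemma flux_nonneg:
  assumes r: "0 \<le> r" "r < 1"
  shows "0 \<le> flux r"
proof -
  have "flux 0 \<le> flux r"
  proof (rule DERIV_nonneg_imp_nondecreasing[OF r(1)])
    fix x assume x: "0 \<le> x" "x \<le> r"
    then have "\<bar>x\<bar> < 1" using r by simp
    have "sphere_integral (\<lambda>_ :: real ^ 'n. 0) \<le> sphere_integral (\<lambda>\<zeta>. lap (x *\<^sub>R \<zeta>))"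
      using \<open>\<bar>x\<bar> < 1\<close> by (intro sphere_integral_mono continuous_on_dilation[OF continuous_on_lap])
        (auto intro: lap_nonneg)
    then have "0 \<le> x ^ (CARD('n) - 1) / (1 - x\<^sup>2) ^ CARD('n) * sphere_integral (\<lambda>\<zeta>. lap (x *\<^sub>R \<zeta>))"
      using x \<open>\<bar>x\<bar> < 1\<close>
      by (intro mult_nonneg_nonneg divide_nonneg_nonneg zero_le_power) (auto simp: abs_square_le_1)
    with DERIV_flux[OF n \<open>\<bar>x\<bar> < 1\<close>]
    show "\<exists>y. (flux has_real_derivative y) (at x) \<and> 0 \<le> y" by blast
  qed
  moreover have "flux 0 = 0"
    using n by (simp add: flux_def zero_power)
  ultimately show ?thesis by simp
qed

lemma mean'_eq_flux:
  assumes r: "0 < r" "r < 1"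
  shows "mean' r = (1 - r\<^sup>2) ^ (CARD('n) - 2) / r ^ (CARD('n) - 1) * flux r"
proof -
  have "1 - r\<^sup>2 > 0" using r by (simp add: abs_square_less_1)
  then show ?thesis using r by (simp add: flux_def)
qed

text \<open>By \<open>mean'_eq_flux\<close> the radial derivative is a nonnegative multiple of the
  flux.\<close>

lemma mean_mono:
  assumes r: "0 < a" "a \<le> r" "r < 1"
  shows "mean a \<le> mean r"
proof (rule DERIV_nonneg_imp_nondecreasing[OF r(2)])
  fix x assume x: "a \<le> x" "x \<le> r"
  have "0 \<le> mean' x"
    using x r flux_nonneg[of x]
    by (subst mean'_eq_flux) (auto intro!: mult_nonneg_nonneg simp: abs_square_le_1)
  with x r show "\<exists>y. (mean has_real_derivative y) (at x) \<and> 0 \<le> y"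
    using DERIV_mean[of x] by auto
qed

text \<open>Green's formula on the annulus \<open>a \<le> |x| \<le> r\<close>; keeping away from the origin avoids the
  singularity of the Green function, at the cost of the harmless boundary terms at \<open>a\<close>.\<close>

lemma green_formula:
  assumes r: "0 < a" "a \<le> r" "r < 1"
  shows "((\<lambda>\<rho>. real CARD('n) * green CARD('n) \<rho> r * (\<rho> ^ (CARD('n) - 1) / (1 - \<rho>\<^sup>2) ^ CARD('n)
            * sphere_integral (\<lambda>\<zeta>. lap (\<rho> *\<^sub>R \<zeta>))))
         has_integral (mean r - mean a - real CARD('n) * green CARD('n) a r * flux a)) {a..r}"
proof -
  let ?n = "CARD('n)"
  \<comment> \<open>An antiderivative found by integration by parts: the derivative of the kernel
    times \<open>flux\<close> equals minus \<open>mean'\<close> and cancels the derivative of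
    \<open>mean\<close>. At the upper end the kernel vanishes.\<close>
  let ?F = "\<lambda>\<rho>. real ?n * green ?n \<rho> r * flux \<rho> + mean \<rho>"
  have "((\<lambda>\<rho>. real ?n * green ?n \<rho> r * (\<rho> ^ (?n - 1) / (1 - \<rho>\<^sup>2) ^ ?n
            * sphere_integral (\<lambda>\<zeta>. lap (\<rho> *\<^sub>R \<zeta>)))) has_integral (?F r - ?F a)) {a..r}"
  proof (rule fundamental_theorem_of_calculus[OF r(2)])
    fix x assume x: "x \<in> {a..r}"
    then have "\<bar>x\<bar> < 1" using r by simp
    have g: "((\<lambda>\<rho>. real ?n * green ?n \<rho> r) has_real_derivative - ((1 - x\<^sup>2) ^ (?n - 2) / x ^ (?n - 1)))
        (at x within {a..r})"
      using DERIV_green[OF _ r(3) r(1) x, of ?n] n by simp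
    note fl = has_field_derivative_at_within[OF DERIV_flux[OF n \<open>\<bar>x\<bar> < 1\<close>], of "{a..r}"]
    note mn = has_field_derivative_at_within[OF DERIV_mean[OF \<open>\<bar>x\<bar> < 1\<close>], of "{a..r}"]
    have "mean' x = (1 - x\<^sup>2) ^ (?n - 2) / x ^ (?n - 1) * flux x"
      using x r by (intro mean'_eq_flux) auto
    then show "(?F has_vector_derivative real ?n * green ?n x r * (x ^ (?n - 1) / (1 - x\<^sup>2) ^ ?n
            * sphere_integral (\<lambda>\<zeta>. lap (x *\<^sub>R \<zeta>)))) (at x within {a..r})"
      using DERIV_add[OF DERIV_mult[OF g fl] mn]
      by (simp add: has_real_derivative_iff_has_vector_derivative mult.commute)
  qed
  moreover have "green ?n r r = 0" by (simp add: green_def)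
  ultimately show ?thesis by (simp add: algebra_simps)
qed

end

end

text \<open>The chain rule: the old derivatives pick up the factor \<phi>', and the new rank-one
  part of the Hessian has trace \<open>\<phi>'' (f x) * (norm (U x))\<^sup>2\<close>.\<close>

lemma C2_ball_compose:
  fixes f :: "real ^ 'n \<Rightarrow> real"
  assumes "C2_ball f U V"
    and \<phi>: "\<And>t. (\<phi> has_real_derivative \<phi>' t) (at t)"
    and \<phi>': "\<And>t. (\<phi>' has_real_derivative \<phi>'' t) (at t)"
    and \<phi>'': "continuous_on UNIV \<phi>''"
  defines "U' \<equiv> \<lambda>x. \<phi>' (f x) *\<^sub>R U x"
    and "V' \<equiv> \<lambda>x. \<chi> j. (\<phi>'' (f x) * U x $ j) *\<^sub>R U x + \<phi>' (f x) *\<^sub>R V x $ j"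
  shows "C2_ball (\<lambda>x. \<phi> (f x)) U' V'"
    and "C2_ball.lap U' V' x
      = \<phi>'' (f x) * ((1 - (norm x)\<^sup>2) * norm (U x))\<^sup>2 + \<phi>' (f x) * C2_ball.lap U V x"
proof -
  interpret f: C2_ball f U V by fact
  have comp: "((\<lambda>x. \<psi> (f x)) has_derivative (\<lambda>h. \<psi>' * (U x \<bullet> h))) (at x)"
    if "(\<psi> has_real_derivative \<psi>') (at (f x))" "norm x < 1" for \<psi> \<psi>' x
    using has_derivative_compose[OF f.u[OF that(2)] that(1)[unfolded has_field_derivative_def]] .
  have cont: "continuous_on (ball 0 1) (\<lambda>x. \<psi> (f x))" if "continuous_on UNIV \<psi>" for \<psi> :: "real \<Rightarrow> real"
    by (rule continuous_on_compose2[OF that f.continuous_on_u]) auto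
  show *: "C2_ball (\<lambda>x. \<phi> (f x)) U' V'"
  proof
    fix x :: "real ^ 'n" assume x: "norm x < 1"
    show "((\<lambda>x. \<phi> (f x)) has_derivative (\<lambda>h. U' x \<bullet> h)) (at x)"
      using comp[OF \<phi> x] by (simp add: U'_def)
    fix j
    show "((\<lambda>x. U' x $ j) has_derivative (\<lambda>h. V' x $ j \<bullet> h)) (at x)"
      using has_derivative_mult[OF comp[OF \<phi>' x] f.U[OF x, of j]]
      unfolding U'_def V'_def
      by (auto simp: inner_add_left algebra_simps fun_eq_iff elim!: has_derivative_eq_rhs)
  next
    have "continuous_on UNIV \<phi>'"
      using \<phi>' by (auto intro!: continuous_at_imp_continuous_on DERIV_isCont)
    then show "continuous_on (ball 0 1) V'"
      unfolding V'_def
      by (intro continuous_intros cont \<phi>'' f.continuous_on_U f.V)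
  qed
  interpret u: C2_ball "\<lambda>x. \<phi> (f x)" U' V' by fact
  have "u.tr x = \<phi>'' (f x) * (norm (U x))\<^sup>2 + \<phi>' (f x) * f.tr x"
    unfolding u.tr_def f.tr_def
    by (simp add: V'_def power2_norm_eq_inner inner_vec_def sum.distrib
        sum_distrib_left mult.assoc)
  then show "u.lap x = \<phi>'' (f x) * ((1 - (norm x)\<^sup>2) * norm (U x))\<^sup>2 + \<phi>' (f x) * f.lap x"
    unfolding u.lap_def f.lap_def
    by (simp add: U'_def power_mult_distrib power2_eq_square algebra_simps)
qed

text \<open>A linear functional is the inner product with the vector of its values on the axes.
  Differentiability in \<open>C2_on\<close> makes \<open>frechet_derivative\<close> a genuine
  derivative, so this applies to it.\<close>

lemma C2_on_imp_C2_ball: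
  assumes "C2_on (ball 0 1) f"
  shows "C2_ball f (grad f) (\<lambda>x. \<chi> j. grad (partial_deriv j f) x)"
proof
  have grad: "(g has_derivative (\<lambda>h. grad g x \<bullet> h)) (at x)"
    if "g differentiable_on ball 0 1" "norm x < 1" for g :: "real ^ 'n \<Rightarrow> real" and x
  proof -
    have "g differentiable (at x)"
      using that by (simp add: differentiable_on_eq_differentiable_at)
    then have d: "(g has_derivative frechet_derivative g (at x)) (at x)"
      by (simp add: frechet_derivative_works)
    then have lin: "linear (frechet_derivative g (at x))"
      by (rule has_derivative_linear)
    have "frechet_derivative g (at x) h = grad g x \<bullet> h" for h
    proof -
      have "frechet_derivative g (at x) (\<Sum>i\<in>UNIV. h $ i *\<^sub>R axis i 1) = grad g x \<bullet> h"
        by (simp add: linear_sum[OF lin] linear_scale[OF lin] grad_def partial_deriv_def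
            inner_vec_def mult.commute)
      then show ?thesis
        using basis_expansion[of h] by (simp add: scalar_mult_eq_scaleR)
    qed
    then have "frechet_derivative g (at x) = (\<lambda>h. grad g x \<bullet> h)" ..
    then show ?thesis using d by simp
  qed
  show "(f has_derivative (\<lambda>h. grad f x \<bullet> h)) (at x)" if "norm x < 1" for x
    using assms that by (intro grad) (auto simp: C2_on_def)
  show "((\<lambda>x. grad f x $ j) has_derivative (\<lambda>h. (\<chi> j. grad (partial_deriv j f) x) $ j \<bullet> h)) (at x)"
    if "norm x < 1" for x j
    using assms grad[OF _ that, of "partial_deriv j f"] by (auto simp: C2_on_def grad_def[of f])
  show "continuous_on (ball 0 1) (\<lambda>x. \<chi> j. grad (partial_deriv j f) x)"
    unfolding grad_def using assms by (intro continuous_on_vec_lambda) (simp add: C2_on_def)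
qed

section \<open>Growth of the integral means\<close>

text \<open>A crude Young inequality: replacing the smaller of \<open>x\<close> and \<open>y\<close>
  by the larger one bounds the product by a single power of order \<open>p\<close>. The argument
  includes \<open>p = 2\<close>.\<close>

lemma powr_mult_square_le:
  fixes x y p :: real
  assumes "x > 0" "y \<ge> 0" "p \<ge> 2"
  shows "x powr (p - 2) * y\<^sup>2 \<le> x powr p + y powr p"
proof (cases "y \<le> x")
  case True
  have "x powr (p - 2) * y\<^sup>2 \<le> x powr (p - 2) * x\<^sup>2"
    using assms True by (intro mult_left_mono power_mono) auto
  also have "\<dots> = x powr p"
    using assms by (simp flip: powr_numeral powr_add)
  finally show ?thesis by (smt (verit) powr_ge_zero)
next
  case False
  have "x powr (p - 2) * y\<^sup>2 \<le> y powr (p - 2) * y\<^sup>2"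
    using assms False by (intro mult_right_mono powr_mono2) auto
  also have "\<dots> = y powr p"
    using assms False by (simp flip: powr_numeral powr_add)
  finally show ?thesis by (smt (verit) powr_ge_zero)
qed

text \<open>Intended for \<open>d\<close> the distance to the boundary and \<open>m\<close> a bound
  for the mean of \<open>E powr (p / 2)\<close>: after averaging, both summands in the bracket stay
  bounded, and the growth sits in the factor in front.\<close>

lemma weighted_young:
  fixes E g m d p :: real
  assumes E: "E > 0" and m: "m > 0" and d: "d > 0" and g: "g \<ge> 0" and p: "p \<ge> 2"
  shows "E powr (p / 2 - 1) * g\<^sup>2
    \<le> m powr (1 - 2 / p) / d\<^sup>2 * (E powr (p / 2) / m + (g powr p) * d powr p)"
proof -
  \<comment> \<open>Chosen so that \<open>x powr p\<close> is \<open>E powr (p / 2) / m\<close>; its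
    partner in Young's inequality is \<open>g * d\<close>.\<close>
  define x where "x = E powr (1 / 2) / m powr (1 / p)"
  have x: "x > 0" using E m by (simp add: x_def)
  have xp: "x powr p = E powr (p / 2) / m"
    using E m p by (simp add: x_def powr_divide powr_powr)
  have xp2: "x powr (p - 2) = E powr (p / 2 - 1) / m powr (1 - 2 / p)"
    using E m p by (simp add: x_def powr_divide powr_powr diff_divide_distrib)
  have "x powr (p - 2) * (g * d)\<^sup>2 \<le> x powr p + (g * d) powr p"
    using x g d p by (intro powr_mult_square_le) auto
  then have "m powr (1 - 2 / p) / d\<^sup>2 * (x powr (p - 2) * (g * d)\<^sup>2)
      \<le> m powr (1 - 2 / p) / d\<^sup>2 * (x powr p + (g * d) powr p)"
    by (intro mult_left_mono) auto
  also have "m powr (1 - 2 / p) / d\<^sup>2 * (x powr (p - 2) * (g * d)\<^sup>2) = E powr (p / 2 - 1) * g\<^sup>2"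
    unfolding xp2 using m d by (simp add: power_mult_distrib)
  finally show ?thesis
    using g d by (simp add: xp powr_mult)
qed

lemma integral_mean_eq:
  "integral_mean p r f = sphere_integral (\<lambda>\<zeta>. norm (f (r *\<^sub>R \<zeta>)) powr p) powr (1 / p)"
  by (simp add: integral_mean_def sphere_integral_def)

lemma integral_one_div_one_minus:
  fixes a r :: real
  assumes "a \<le> r" "r < 1"
  shows "((\<lambda>\<rho>. 1 / (1 - \<rho>)) has_integral (ln (1 - a) - ln (1 - r))) {a..r}"
proof -
  have "((\<lambda>\<rho>. 1 / (1 - \<rho>)) has_integral (- ln (1 - r) - - ln (1 - a))) {a..r}"
    using assms
    by (intro fundamental_theorem_of_calculus)
       (auto simp flip: has_real_derivative_iff_has_vector_derivative intro!: derivative_eq_intros)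
  then show ?thesis by simp
qed

lemma DERIV_one_plus_square_powr:
  "((\<lambda>t :: real. (1 + t\<^sup>2) powr q) has_real_derivative 2 * q * t * (1 + t\<^sup>2) powr (q - 1)) (at t)"
proof -
  have pos: "1 + t\<^sup>2 > 0" by (simp add: add_pos_nonneg)
  have "((\<lambda>t. 1 + t\<^sup>2) has_real_derivative 2 * t) (at t)"
    by (auto intro!: derivative_eq_intros)
  from DERIV_powr[OF this pos DERIV_const, of q] pos show ?thesis
    by (simp add: powr_diff field_simps)
qed

text \<open>The growth condition controls radii near 1 only. On the remaining compact ball
  continuity bounds \<open>g\<close>, and the sum of the two constants serves all radii.\<close>

lemma sphere_mean_bounded_of_bigo:
  fixes g :: "real ^ 'n \<Rightarrow> real ^ 'n"
  assumes g: "continuous_on (ball 0 1) g" and p: "p \<ge> 2"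
    and O: "(\<lambda>r. integral_mean p r g) \<in> O[at_left 1](\<lambda>r. 1 / (1 - r))"
  obtains C where "C \<ge> 0"
    "\<And>r. 0 \<le> r \<Longrightarrow> r < 1 \<Longrightarrow>
      sphere_integral (\<lambda>\<zeta>. norm (g (r *\<^sub>R \<zeta>)) powr p) * (1 - r) powr p \<le> C"
proof -
  let ?I = "\<lambda>r. sphere_integral (\<lambda>\<zeta>. norm (g (r *\<^sub>R \<zeta>)) powr p)"
  have cont: "continuous_on (sphere 0 1) (\<lambda>\<zeta>. norm (g (r *\<^sub>R \<zeta>)) powr p)" if "0 \<le> r" "r < 1" for r
    using that p
    by (intro continuous_on_powr' continuous_intros continuous_on_compose2[OF g]) auto
  have I0: "0 \<le> ?I r" if "0 \<le> r" "r < 1" for r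
    using sphere_integral_mono[OF _ cont[OF that], of "\<lambda>_. 0"] by simp
  obtain c where c: "c > 0"
    and "\<forall>\<^sub>F r in at_left 1. norm (integral_mean p r g) \<le> c * norm (1 / (1 - r))"
    using landau_o.bigE[OF O] by blast
  then obtain b where b: "b < 1"
    and cb: "\<And>r. b < r \<Longrightarrow> r < 1 \<Longrightarrow> norm (integral_mean p r g) \<le> c * norm (1 / (1 - r))"
    unfolding eventually_at_left_field by blast
  \<comment> \<open>The threshold \<open>b\<close> may be negative; the maximum with 0 keeps the
    radius nonnegative.\<close>
  have "compact (cball (0 :: real ^ 'n) (max 0 b))" by simp
  moreover have "continuous_on (cball 0 (max 0 b)) g"
    using b by (intro continuous_on_subset[OF g]) auto
  ultimately have "bounded (g ` cball 0 (max 0 b))"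
    by (intro compact_imp_bounded compact_continuous_image)
  then obtain B where B0: "\<forall>y\<in>g ` cball 0 (max 0 b). norm y \<le> B"
    unfolding bounded_iff by blast
  show ?thesis
  proof
    show "0 \<le> c powr p + \<bar>B\<bar> powr p" by simp
    fix r :: real assume r: "0 \<le> r" "r < 1"
    show "?I r * (1 - r) powr p \<le> c powr p + \<bar>B\<bar> powr p"
    proof (cases "r \<le> b")
      case True
      have "norm (g (r *\<^sub>R \<zeta>)) powr p \<le> \<bar>B\<bar> powr p" if "norm \<zeta> = 1" for \<zeta>
      proof -
        have "g (r *\<^sub>R \<zeta>) \<in> g ` cball 0 (max 0 b)" using that r True by auto
        then have "norm (g (r *\<^sub>R \<zeta>)) \<le> B" using B0 by blast
        then show ?thesis using p by (intro powr_mono2) auto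
      qed
      then have "?I r \<le> sphere_integral (\<lambda>_ :: real ^ 'n. \<bar>B\<bar> powr p)"
        using r by (intro sphere_integral_mono cont) auto
      then have "?I r \<le> \<bar>B\<bar> powr p" by simp
      moreover have "(1 - r) powr p \<le> 1" using r p by (simp add: powr_le1)
      ultimately have "?I r * (1 - r) powr p \<le> \<bar>B\<bar> powr p * 1"
        using I0[OF r] by (intro mult_mono) auto
      then show ?thesis using powr_ge_zero[of c p] by linarith
    next
      case False
      then have "?I r powr (1 / p) \<le> c / (1 - r)"
        using cb[of r] r by (simp add: integral_mean_eq)
      then have "(?I r powr (1 / p)) powr p \<le> (c / (1 - r)) powr p"
        using p by (intro powr_mono2) auto
      then have "?I r \<le> c powr p / (1 - r) powr p"
        using I0[OF r] r c p by (simp add: powr_powr powr_divide)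
      then have "?I r * (1 - r) powr p \<le> c powr p"
        using r by (simp add: field_simps)
      then show ?thesis using powr_ge_zero[of "\<bar>B\<bar>" p] by linarith
    qed
  qed
qed

theorem corollary1p5:
  fixes f :: "real ^ 'n \<Rightarrow> real" and p M :: real and l\<^sub>2 :: "real \<Rightarrow> real"
  assumes "CARD('n) \<ge> 2"
    and "p \<ge> 2"
    and "M \<ge> 0"
    and "continuous_on {0..<1} l\<^sub>2"
    and "\<And>\<rho>. \<rho> \<in> {0..<1} \<Longrightarrow> l\<^sub>2 \<rho> \<ge> 0"
    and "(SUP r\<in>{0..<1}. ereal (integral {0..r}
            (\<lambda>\<rho>. \<rho> ^ (CARD('n) - 1) * green CARD('n) \<rho> r * l\<^sub>2 \<rho> / (1 - \<rho>\<^sup>2) ^ CARD('n))))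
         < ereal (1 / (real CARD('n) * p))"
    and "f \<in> H_class (\<lambda>_. M) l\<^sub>2"
    and "(\<lambda>r. integral_mean p r (grad f)) \<in> O[at_left 1](\<lambda>r. 1 / (1 - r))"
  shows "(\<lambda>r. integral_mean p r f) \<in> O[at_left 1](\<lambda>r. (ln (1 / (1 - r))) powr (1 / 2))"
proof -
  note n = assms(1) and p = assms(2) and M = assms(3)
  let ?n = "CARD('n)"
  let ?H = "\<lambda>x. \<chi> j. grad (partial_deriv j f) x"
  let ?w = "\<lambda>r \<rho>. \<rho> ^ (?n - 1) * green ?n \<rho> r * l\<^sub>2 \<rho> / (1 - \<rho>\<^sup>2) ^ ?n"

  \<comment> \<open>Explicit derivatives and the class condition\<close>
  have "C2_on (ball 0 1) f"
    using assms(7) by (simp add: H_class_def)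
  then have C2: "C2_ball f (grad f) ?H"
    by (rule C2_on_imp_C2_ball)
  interpret f: C2_ball f "grad f" ?H by fact
  have lap_f: "f.lap x = hyp_laplacian f x" for x
    unfolding f.lap_def f.tr_def hyp_laplacian_def laplacian_def
    by (simp add: grad_def[of "partial_deriv _ f"])
  have H: "0 \<le> f x * hyp_laplacian f x"
    "f x * hyp_laplacian f x \<le> M * ((1 - (norm x)\<^sup>2) * norm (grad f x))\<^sup>2 + l\<^sub>2 (norm x) * (f x)\<^sup>2"
    if "norm x < 1" for x
    using assms(7) that by (auto simp: H_class_def hyp_grad_def power_mult_distrib)

  \<comment> \<open>The base is positive, so one formula for each derivative holds for all
    \<open>t\<close>, zeros included. Moreover \<phi> is at least 1, which keeps the means away from
    0.\<close>
  define \<phi> where "\<phi> = (\<lambda>t :: real. (1 + t\<^sup>2) powr (p / 2))"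
  define \<phi>' where "\<phi>' = (\<lambda>t :: real. p * (t * (1 + t\<^sup>2) powr (p / 2 - 1)))"
  define \<phi>'' where "\<phi>'' = (\<lambda>t :: real. p * (1 + t\<^sup>2) powr (p / 2 - 1)
      + p * (p - 2) * t\<^sup>2 * (1 + t\<^sup>2) powr (p / 2 - 2))"
  have pos: "1 + t\<^sup>2 > 0" for t :: real by (simp add: add_pos_nonneg)
  have \<phi>1: "(\<phi> has_real_derivative \<phi>' t) (at t)" for t
    using DERIV_one_plus_square_powr[of "p / 2" t] by (simp add: \<phi>_def \<phi>'_def mult.assoc)
  have \<phi>2: "(\<phi>' has_real_derivative \<phi>'' t) (at t)" for t
    using DERIV_cmult[OF DERIV_mult[OF DERIV_ident DERIV_one_plus_square_powr[of "p / 2 - 1" t]], of p]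
    unfolding \<phi>'_def \<phi>''_def by (simp add: algebra_simps power2_eq_square)
  have \<phi>''c: "continuous_on UNIV \<phi>''"
    unfolding \<phi>''_def using pos by (intro continuous_intros) (metis less_irrefl)+
  have \<phi>''0: "0 \<le> \<phi>'' t" for t
    unfolding \<phi>''_def using p by simp
  \<comment> \<open>Bounding \<open>t\<^sup>2\<close> by \<open>1 + t\<^sup>2\<close> merges both
    terms, with coefficient \<open>1 + (p - 2)\<close>.\<close>
  have \<phi>''_le: "\<phi>'' t \<le> p * (p - 1) * (1 + t\<^sup>2) powr (p / 2 - 1)" for t
  proof -
    have "t\<^sup>2 * (1 + t\<^sup>2) powr (p / 2 - 2) \<le> (1 + t\<^sup>2) * (1 + t\<^sup>2) powr (p / 2 - 2)"
      by (intro mult_right_mono) auto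
    also have "\<dots> = (1 + t\<^sup>2) powr (p / 2 - 1)"
      using pos[of t] by (simp add: powr_mult_base)
    finally have "p * (p - 2) * (t\<^sup>2 * (1 + t\<^sup>2) powr (p / 2 - 2)) \<le> p * (p - 2) * (1 + t\<^sup>2) powr (p / 2 - 1)"
      using p by (intro mult_left_mono) auto
    then show ?thesis unfolding \<phi>''_def by (simp add: algebra_simps)
  qed

  \<comment> \<open>The comparison function and its invariant Laplacian\<close>
  let ?u = "\<lambda>x. \<phi> (f x)"
  let ?U = "\<lambda>x. \<phi>' (f x) *\<^sub>R grad f x"
  let ?V = "\<lambda>x. \<chi> j. (\<phi>'' (f x) * grad f x $ j) *\<^sub>R grad f x + \<phi>' (f x) *\<^sub>R ?H x $ j"
  interpret u: C2_ball ?u ?U ?V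
    by (rule C2_ball_compose(1)[OF C2 \<phi>1 \<phi>2 \<phi>''c])
  \<comment> \<open>The factor \<open>t\<close> in \<phi>' produces the product
    \<open>f x * hyp_laplacian f x\<close>, which the class condition controls.\<close>
  have lap_u: "u.lap x = \<phi>'' (f x) * ((1 - (norm x)\<^sup>2) * norm (grad f x))\<^sup>2
      + p * (1 + (f x)\<^sup>2) powr (p / 2 - 1) * (f x * hyp_laplacian f x)" for x
    using C2_ball_compose(2)[OF C2 \<phi>1 \<phi>2 \<phi>''c, of x] by (simp add: lap_f \<phi>'_def mult_ac)
  have lap_u0: "0 \<le> u.lap x" if "norm x < 1" for x
    unfolding lap_u using H[OF that] \<phi>''0 p by simp
  \<comment> \<open>The part \<open>p * (p - 1)\<close> comes from \<phi>'' and the part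
    \<open>p * M\<close> from the class condition.\<close>
  define k where "k = p * (p - 1 + M)"
  have k: "k \<ge> 0" using p M by (simp add: k_def)
  let ?D = "\<lambda>x. (1 + (f x)\<^sup>2) powr (p / 2 - 1) * (norm (grad f x))\<^sup>2"
  have lap_u_le: "u.lap x \<le> k * (1 - (norm x)\<^sup>2)\<^sup>2 * ?D x + p * l\<^sub>2 (norm x) * ?u x"
    if x: "norm x < 1" for x
  proof -
    let ?e = "(1 + (f x)\<^sup>2) powr (p / 2 - 1)" and ?g = "((1 - (norm x)\<^sup>2) * norm (grad f x))\<^sup>2"
    have l2: "0 \<le> l\<^sub>2 (norm x)" using assms(5) x by simp
    have "u.lap x \<le> p * (p - 1) * ?e * ?g + p * ?e * (M * ?g + l\<^sub>2 (norm x) * (f x)\<^sup>2)"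
      unfolding lap_u using H[OF x] \<phi>''_le[of "f x"] p
      by (intro add_mono mult_right_mono mult_left_mono) auto
    also have "\<dots> = k * ?e * ?g + p * l\<^sub>2 (norm x) * ((f x)\<^sup>2 * ?e)"
      by (simp add: k_def algebra_simps)
    also have "\<dots> \<le> k * ?e * ?g + p * l\<^sub>2 (norm x) * ((1 + (f x)\<^sup>2) * ?e)"
      using p l2 by (intro add_left_mono mult_left_mono mult_right_mono) auto
    also have "(1 + (f x)\<^sup>2) * ?e = ?u x"
      using pos[of "f x"] by (simp add: powr_mult_base \<phi>_def)
    finally show ?thesis by (simp add: power_mult_distrib mult_ac)
  qed

  \<comment> \<open>Averages over spheres\<close>
  have fc: "continuous_on (sphere 0 1) (\<lambda>\<zeta>. f (r *\<^sub>R \<zeta>))"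
    and gc: "continuous_on (sphere 0 1) (\<lambda>\<zeta>. grad f (r *\<^sub>R \<zeta>))" if "\<bar>r\<bar> < 1" for r
    using that f.continuous_on_dilation[OF f.continuous_on_u] f.continuous_on_dilation[OF f.continuous_on_U]
    by auto
  have Dc: "continuous_on (sphere 0 1) (\<lambda>\<zeta>. ?D (r *\<^sub>R \<zeta>))" if "\<bar>r\<bar> < 1" for r
    using pos by (intro continuous_intros fc[OF that] gc[OF that]) (metis less_irrefl)
  have uc: "continuous_on (sphere 0 1) (\<lambda>\<zeta>. ?u (r *\<^sub>R \<zeta>))" if "\<bar>r\<bar> < 1" for r
    using that by (intro u.continuous_on_dilation u.continuous_on_u)
  have gpc: "continuous_on (sphere 0 1) (\<lambda>\<zeta>. norm (grad f (r *\<^sub>R \<zeta>)) powr p)" if "\<bar>r\<bar> < 1" for r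
    using p by (intro continuous_on_powr' continuous_intros gc[OF that]) auto

  have u1: "1 \<le> ?u x" for x
    unfolding \<phi>_def using p by (intro ge_one_powr_ge_zero) auto
  have mean1: "1 \<le> u.mean r" if "\<bar>r\<bar> < 1" for r
    unfolding u.mean_def
    using sphere_integral_mono[OF _ uc[OF that], of "\<lambda>_. 1"] u1 by simp

  obtain C where C: "C \<ge> 0" and grad_le: "\<And>r. 0 \<le> r \<Longrightarrow> r < 1 \<Longrightarrow>
      sphere_integral (\<lambda>\<zeta>. norm (grad f (r *\<^sub>R \<zeta>)) powr p) * (1 - r) powr p \<le> C"
    using sphere_mean_bounded_of_bigo[OF f.continuous_on_U p assms(8)] by blast
  have D_le: "sphere_integral (\<lambda>\<zeta>. ?D (\<rho> *\<^sub>R \<zeta>)) \<le> m powr (1 - 2 / p) / (1 - \<rho>)\<^sup>2 * (1 + C)"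
    if \<rho>: "0 \<le> \<rho>" "\<rho> < 1" and m: "u.mean \<rho> \<le> m" for \<rho> m
  proof -
    have r: "\<bar>\<rho>\<bar> < 1" using \<rho> by simp
    have m0: "m > 0" using m mean1[OF r] by simp
    let ?G = "\<lambda>\<zeta>. norm (grad f (\<rho> *\<^sub>R \<zeta>)) powr p"
    let ?\<Theta> = "m powr (1 - 2 / p) / (1 - \<rho>)\<^sup>2"
    have c1: "continuous_on (sphere 0 1) (\<lambda>\<zeta>. 1 / m * ?u (\<rho> *\<^sub>R \<zeta>))"
      and c2: "continuous_on (sphere 0 1) (\<lambda>\<zeta>. (1 - \<rho>) powr p * ?G \<zeta>)"
      by (intro continuous_intros uc[OF r] gpc[OF r])+
    have "sphere_integral (\<lambda>\<zeta>. ?D (\<rho> *\<^sub>R \<zeta>))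
        \<le> sphere_integral (\<lambda>\<zeta>. ?\<Theta> * (1 / m * ?u (\<rho> *\<^sub>R \<zeta>) + (1 - \<rho>) powr p * ?G \<zeta>))"
    proof (rule sphere_integral_mono[OF Dc[OF r]])
      show "continuous_on (sphere 0 1) (\<lambda>\<zeta>. ?\<Theta> * (1 / m * ?u (\<rho> *\<^sub>R \<zeta>) + (1 - \<rho>) powr p * ?G \<zeta>))"
        by (intro continuous_on_mult continuous_on_add continuous_on_const c1 c2)
      fix \<zeta> :: "real ^ 'n"
      show "?D (\<rho> *\<^sub>R \<zeta>) \<le> ?\<Theta> * (1 / m * ?u (\<rho> *\<^sub>R \<zeta>) + (1 - \<rho>) powr p * ?G \<zeta>)"
        using weighted_young[OF pos m0 _ norm_ge_zero p, of "1 - \<rho>" "f (\<rho> *\<^sub>R \<zeta>)" "grad f (\<rho> *\<^sub>R \<zeta>)"] \<rho>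
        by (simp add: \<phi>_def mult.commute)
    qed
    also have "\<dots> = ?\<Theta> * (1 / m * u.mean \<rho> + (1 - \<rho>) powr p * sphere_integral ?G)"
      unfolding sphere_integral_cmult sphere_integral_add[OF c1 c2] u.mean_def ..
    also have "\<dots> \<le> ?\<Theta> * (1 + C)"
      using m m0 grad_le[OF \<rho>] by (intro mult_left_mono add_mono) (auto simp: mult.commute)
    finally show ?thesis .
  qed

  \<comment> \<open>A real number strictly between the supremum, which is taken in
    \<open>ereal\<close>, and its bound turns the strict inequality into a uniform factor \<kappa>
    below 1.\<close>
  obtain c where "ereal c < ereal (1 / (real ?n * p))"
    and "(SUP r\<in>{0..<1}. ereal (integral {0..r} (?w r))) < ereal c"
    using ereal_dense2[OF assms(6)] by blast
  then have c: "c < 1 / (real ?n * p)"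
    and SUP: "(SUP r\<in>{0..<1}. ereal (integral {0..r} (?w r))) < ereal c"
    by simp_all
  have w_le: "integral {0..r} (?w r) \<le> c" if "r \<in> {0..<1}" for r
  proof -
    have "ereal (integral {0..r} (?w r)) \<le> (SUP r\<in>{0..<1}. ereal (integral {0..r} (?w r)))"
      by (rule SUP_upper[OF that])
    from order_le_less_trans[OF this SUP] show ?thesis by simp
  qed
  define \<kappa> where "\<kappa> = real ?n * p * c"
  have \<kappa>: "\<kappa> < 1"
    using c n p by (simp add: \<kappa>_def field_simps)

  let ?a = "1 / 2 :: real"
  \<comment> \<open>\<open>A\<close> dominates the boundary terms of Green's formula at the inner
    radius; \<open>green_le\<close> makes this independent of \<open>r\<close>.\<close>
  define A where "A = u.mean ?a + (1 - ?a\<^sup>2) ^ (?n - 2) / ?a ^ (?n - 1) * (1 - ?a) * u.flux ?a"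
  define B where "B = k * (1 + C)"
  have B: "B \<ge> 0" using k C by (simp add: B_def)
  have flux0: "0 \<le> u.flux ?a"
    by (rule u.flux_nonneg[OF n lap_u0]) auto
  have A: "A \<ge> 0"
    unfolding A_def using mean1[of ?a] flux0
    by (intro add_nonneg_nonneg mult_nonneg_nonneg divide_nonneg_nonneg zero_le_power)
       (auto simp: power2_eq_square)

  have main: "(1 - \<kappa>) * u.mean r \<le> A + B * u.mean r powr (1 - 2 / p) * ln (1 / (1 - r))"
    if r: "?a \<le> r" "r < 1" for r
  proof -
    define m where "m = u.mean r"
    have m1: "m \<ge> 1" using mean1[of r] r by (simp add: m_def)
    let ?K = "\<lambda>\<rho>. real ?n * green ?n \<rho> r"
    let ?N = "\<lambda>\<rho>. sphere_integral (\<lambda>\<zeta>. u.lap (\<rho> *\<^sub>R \<zeta>))"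
    let ?rhs = "\<lambda>\<rho>. real ?n * p * m * ?w r \<rho> + B * m powr (1 - 2 / p) * (1 / (1 - \<rho>))"
    have wi: "?w r integrable_on {0..r}"
      using r n by (intro green_weight_integrable continuous_on_subset[OF assms(4)]) auto
    then have wi': "?w r integrable_on {?a..r}"
      by (rule integrable_on_subinterval) auto
    have w0: "0 \<le> ?w r \<rho>" if "\<rho> \<in> {0..r}" for \<rho>
    proof (cases "\<rho> = 0")
      case True
      then show ?thesis using n by (simp add: zero_power)
    next
      case False
      then have "0 \<le> green ?n \<rho> r" using that r n by (intro green_nonneg) auto
      then show ?thesis using that r assms(5)[of \<rho>]
        by (intro divide_nonneg_nonneg mult_nonneg_nonneg zero_le_power) (auto simp: abs_square_le_1)
    qed
    \<comment> \<open>The hypothesis concerns \<open>{0..r}\<close>, Green's formula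
      \<open>{?a..r}\<close>; nonnegativity of the weight permits the passage.\<close>
    have "integral {?a..r} (?w r) \<le> integral {0..r} (?w r)"
      by (rule integral_subset_le[OF _ wi' wi]) (use w0 in auto)
    also have "\<dots> \<le> c" using w_le r by simp
    finally have wc: "integral {?a..r} (?w r) \<le> c" .
    have rhs: "(?rhs has_integral (real ?n * p * m * integral {?a..r} (?w r)
        + B * m powr (1 - 2 / p) * (ln (1 - ?a) - ln (1 - r)))) {?a..r}"
      using r by (intro has_integral_add has_integral_mult_right integrable_integral[OF wi']
          integral_one_div_one_minus)
    have green: "((\<lambda>\<rho>. ?K \<rho> * (\<rho> ^ (?n - 1) / (1 - \<rho>\<^sup>2) ^ ?n * ?N \<rho>))
         has_integral (m - u.mean ?a - ?K ?a * u.flux ?a)) {?a..r}"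
      unfolding m_def by (rule u.green_formula[OF n lap_u0]) (use r in auto)
    have "m - u.mean ?a - ?K ?a * u.flux ?a \<le> real ?n * p * m * integral {?a..r} (?w r)
        + B * m powr (1 - 2 / p) * (ln (1 - ?a) - ln (1 - r))"
    proof (rule has_integral_le[OF green rhs])
      fix \<rho> assume \<rho>: "\<rho> \<in> {?a..r}"
      then have \<rho>1: "\<bar>\<rho>\<bar> < 1" "0 < \<rho>" "\<rho> < 1" using r by auto
      define q where "q = 1 - \<rho>\<^sup>2"
      have q: "q > 0" using \<rho>1 by (simp add: q_def abs_square_less_1)
      have qn: "q ^ ?n = q ^ (?n - 2) * q\<^sup>2"
        using n by (simp only: power_add[symmetric] le_add_diff_inverse2)
      let ?I = "sphere_integral (\<lambda>\<zeta>. ?D (\<rho> *\<^sub>R \<zeta>))"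
      have l2: "0 \<le> l\<^sub>2 \<rho>" using assms(5) \<rho>1 by simp
      have mm: "u.mean \<rho> \<le> m"
        unfolding m_def by (rule u.mean_mono[OF n lap_u0]) (use \<rho> r in auto)
      have c1: "continuous_on (sphere 0 1) (\<lambda>\<zeta>. k * q\<^sup>2 * ?D (\<rho> *\<^sub>R \<zeta>))"
        and c2: "continuous_on (sphere 0 1) (\<lambda>\<zeta>. p * l\<^sub>2 \<rho> * ?u (\<rho> *\<^sub>R \<zeta>))"
        by (intro continuous_on_mult continuous_on_const uc[OF \<rho>1(1)] Dc[OF \<rho>1(1)])+
      have "?N \<rho> \<le> sphere_integral (\<lambda>\<zeta>. k * q\<^sup>2 * ?D (\<rho> *\<^sub>R \<zeta>) + p * l\<^sub>2 \<rho> * ?u (\<rho> *\<^sub>R \<zeta>))"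
      proof (rule sphere_integral_mono[OF u.continuous_on_dilation[OF u.continuous_on_lap \<rho>1(1)]
            continuous_on_add[OF c1 c2]])
        fix \<zeta> :: "real ^ 'n" assume "norm \<zeta> = 1"
        then show "u.lap (\<rho> *\<^sub>R \<zeta>) \<le> k * q\<^sup>2 * ?D (\<rho> *\<^sub>R \<zeta>) + p * l\<^sub>2 \<rho> * ?u (\<rho> *\<^sub>R \<zeta>)"
          using lap_u_le[of "\<rho> *\<^sub>R \<zeta>"] \<rho>1 by (simp add: q_def)
      qed
      also have "\<dots> = k * q\<^sup>2 * ?I + p * l\<^sub>2 \<rho> * u.mean \<rho>"
        unfolding sphere_integral_add[OF c1 c2] sphere_integral_cmult u.mean_def ..
      also have "\<dots> \<le> k * q\<^sup>2 * (m powr (1 - 2 / p) / (1 - \<rho>)\<^sup>2 * (1 + C)) + p * l\<^sub>2 \<rho> * m"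
        using \<rho>1 mm k p l2 by (intro add_mono mult_left_mono D_le mult_nonneg_nonneg) auto
      finally have N: "?N \<rho> \<le> B * m powr (1 - 2 / p) * (q\<^sup>2 / (1 - \<rho>)\<^sup>2) + p * l\<^sub>2 \<rho> * m"
        by (simp add: B_def mult_ac)
      have K0: "0 \<le> ?K \<rho> * (\<rho> ^ (?n - 1) / q ^ ?n)"
        using green_nonneg[OF _ r(2) \<rho>1(2), of ?n] n q \<rho>1 by simp
      \<comment> \<open>By \<open>green_le\<close> the kernel supplies
        \<open>q ^ (?n - 2) * (1 - \<rho>)\<close>, and the hyperbolic gradient supplies
        \<open>q\<^sup>2\<close>. Together they cancel \<open>q ^ ?n\<close> and leave one factor
        \<open>1 - \<rho>\<close> against two in the denominator.\<close>
      have "?K \<rho> * \<rho> ^ (?n - 1) \<le> q ^ (?n - 2) / \<rho> ^ (?n - 1) * (1 - \<rho>) * \<rho> ^ (?n - 1)"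
        using green_le[OF _ r(2) \<rho>1(2), of ?n] n \<rho> \<rho>1 by (intro mult_right_mono) (auto simp: q_def)
      also have "\<dots> = q ^ (?n - 2) * (1 - \<rho>)"
        using \<rho>1 by simp
      finally have "?K \<rho> * \<rho> ^ (?n - 1) / q ^ ?n * (q\<^sup>2 / (1 - \<rho>)\<^sup>2)
          \<le> q ^ (?n - 2) * (1 - \<rho>) / q ^ ?n * (q\<^sup>2 / (1 - \<rho>)\<^sup>2)"
        using q by (intro mult_right_mono divide_right_mono) auto
      also have "q ^ (?n - 2) * (1 - \<rho>) / q ^ ?n * (q\<^sup>2 / (1 - \<rho>)\<^sup>2) = 1 / (1 - \<rho>)"
        unfolding qn using q \<rho>1 by (simp add: power2_eq_square)
      finally have Kq: "?K \<rho> * (\<rho> ^ (?n - 1) / q ^ ?n) * (q\<^sup>2 / (1 - \<rho>)\<^sup>2) \<le> 1 / (1 - \<rho>)"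
        by simp
      have "?K \<rho> * (\<rho> ^ (?n - 1) / q ^ ?n) * ?N \<rho>
          \<le> ?K \<rho> * (\<rho> ^ (?n - 1) / q ^ ?n) * (B * m powr (1 - 2 / p) * (q\<^sup>2 / (1 - \<rho>)\<^sup>2) + p * l\<^sub>2 \<rho> * m)"
        by (intro mult_left_mono N K0)
      also have "\<dots> = B * m powr (1 - 2 / p) * (?K \<rho> * (\<rho> ^ (?n - 1) / q ^ ?n) * (q\<^sup>2 / (1 - \<rho>)\<^sup>2))
          + real ?n * p * m * ?w r \<rho>"
        by (simp add: q_def algebra_simps)
      also have "\<dots> \<le> B * m powr (1 - 2 / p) * (1 / (1 - \<rho>)) + real ?n * p * m * ?w r \<rho>"
        using B by (intro add_right_mono mult_left_mono Kq) auto
      finally show "?K \<rho> * (\<rho> ^ (?n - 1) / (1 - \<rho>\<^sup>2) ^ ?n * ?N \<rho>) \<le> ?rhs \<rho>"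
        by (simp add: q_def mult.assoc)
    qed
    \<comment> \<open>The weight integral becomes \<kappa> times \<open>m\<close>, to be absorbed on
      the left; \<open>ln (1 - ?a)\<close> is negative and is dropped.\<close>
    also have "\<dots> \<le> real ?n * p * m * c + B * m powr (1 - 2 / p) * ln (1 / (1 - r))"
    proof (intro add_mono mult_left_mono wc)
      show "ln (1 - ?a) - ln (1 - r) \<le> ln (1 / (1 - r))"
        using r by (simp add: ln_div)
    qed (use p m1 B in auto)
    finally have "m \<le> u.mean ?a + ?K ?a * u.flux ?a + \<kappa> * m + B * m powr (1 - 2 / p) * ln (1 / (1 - r))"
      by (simp add: \<kappa>_def mult_ac)
    moreover have "?K ?a * u.flux ?a \<le> (1 - ?a\<^sup>2) ^ (?n - 2) / ?a ^ (?n - 1) * (1 - ?a) * u.flux ?a"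
      using r n flux0 by (intro mult_right_mono green_le) auto
    ultimately show ?thesis
      unfolding A_def m_def[symmetric] by (simp add: algebra_simps)
  qed

  \<comment> \<open>From the growth inequality to the logarithmic bound\<close>
  define Q where "Q = (A + B) / (1 - \<kappa>)"
  have Q: "Q \<ge> 0" using A B \<kappa> by (simp add: Q_def)
  \<comment> \<open>Beyond this threshold \<open>L\<close> is at least 1 and \<open>r\<close> at
    least \<open>1 / 2\<close>. So \<open>main\<close> applies and the constant \<open>A\<close> can
    be absorbed into the logarithmic term.\<close>
  have bound: "integral_mean p r f \<le> Q powr (1 / 2) * ln (1 / (1 - r)) powr (1 / 2)"
    if r: "1 - exp (- 1) \<le> r" "r < 1" for r
  proof -
    define m where "m = u.mean r"
    define L where "L = ln (1 / (1 - r))"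
    have "exp (- 1) \<le> (1 / 2 :: real)"
      using exp_ge_add_one_self[of "1::real"] by (simp add: exp_minus field_simps)
    then have r2: "1 / 2 \<le> r" using r by simp
    have m1: "m \<ge> 1" using mean1[of r] r r2 by (simp add: m_def)
    have "ln (1 - r) \<le> ln (exp (- 1))"
      using r by (intro ln_mono) auto
    then have L: "L \<ge> 1" using r by (simp add: L_def ln_div)
    let ?t = "m powr (1 - 2 / p)"
    have t1: "?t \<ge> 1" using m1 p by (intro ge_one_powr_ge_zero) auto
    have "1 * 1 \<le> ?t * L" using t1 L by (intro mult_mono) auto
    then have "A * 1 \<le> A * (?t * L)" by (intro mult_left_mono A) simp
    then have "(1 - \<kappa>) * m \<le> (A + B) * L * ?t"
      using main[OF r2 r(2)] by (simp add: m_def L_def algebra_simps)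
    \<comment> \<open>Splitting \<open>m\<close> this way lets \<open>?t\<close> cancel, leaving a
      bound for \<open>m powr (2 / p)\<close> that is linear in \<open>L\<close>.\<close>
    moreover have "m powr (2 / p) * ?t = m"
      using m1 by (simp flip: powr_add)
    ultimately have "((1 - \<kappa>) * m powr (2 / p)) * ?t \<le> ((A + B) * L) * ?t"
      by (simp only: mult.assoc)
    then have "(1 - \<kappa>) * m powr (2 / p) \<le> (A + B) * L"
      by (rule mult_right_le_imp_le) (use m1 in simp)
    then have mQ: "m powr (2 / p) \<le> Q * L"
      using \<kappa> by (simp add: Q_def field_simps)
    have fp: "continuous_on (sphere 0 1) (\<lambda>\<zeta>. norm (f (r *\<^sub>R \<zeta>)) powr p)"
      using p r r2 by (intro continuous_on_powr' continuous_intros fc) auto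
    have "norm t powr p \<le> \<phi> t" for t
    proof -
      have "norm t powr p = (t\<^sup>2) powr (p / 2)"
      proof (cases "t = 0")
        case False
        then have "t\<^sup>2 = \<bar>t\<bar> powr 2" by simp
        then show ?thesis by (simp only: powr_powr) simp
      qed simp
      also have "\<dots> \<le> \<phi> t" unfolding \<phi>_def using p by (intro powr_mono2) auto
      finally show ?thesis .
    qed
    then have "sphere_integral (\<lambda>\<zeta>. norm (f (r *\<^sub>R \<zeta>)) powr p) \<le> m"
      unfolding m_def u.mean_def using r r2 by (intro sphere_integral_mono fp uc) auto
    moreover have "0 \<le> sphere_integral (\<lambda>\<zeta>. norm (f (r *\<^sub>R \<zeta>)) powr p)"
      using sphere_integral_mono[OF _ fp, of "\<lambda>_. 0"] by simp
    ultimately have "integral_mean p r f \<le> m powr (1 / p)"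
      unfolding integral_mean_eq using p by (intro powr_mono2) auto
    \<comment> \<open>The root of order \<open>p\<close> of \<open>m\<close> is the square root of
      the quantity just bounded, whence the exponent \<open>1 / 2\<close> of the logarithm.\<close>
    also have "\<dots> = (m powr (2 / p)) powr (1 / 2)"
      by (simp add: powr_powr)
    also have "\<dots> \<le> (Q * L) powr (1 / 2)"
      using mQ by (intro powr_mono2) auto
    also have "\<dots> = Q powr (1 / 2) * L powr (1 / 2)"
      using Q L by (simp add: powr_mult)
    finally show ?thesis by (simp add: L_def)
  qed
  have "\<forall>\<^sub>F r in at_left 1. norm (integral_mean p r f)
      \<le> Q powr (1 / 2) * norm (ln (1 / (1 - r)) powr (1 / 2))"
    unfolding eventually_at_left_field
  proof (intro exI[of _ "1 - exp (- 1) :: real"] conjI allI impI)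
    fix r :: real assume "1 - exp (- 1) < r" "r < 1"
    then show "norm (integral_mean p r f) \<le> Q powr (1 / 2) * norm (ln (1 / (1 - r)) powr (1 / 2))"
      using bound[of r] by (simp add: integral_mean_eq)
  qed simp
  then show ?thesis by (rule bigoI)
qed

end
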